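(* Let $p$ be an odd prime and $X=R_p$. Let $A_m\in H^{2m}(X;X;\mathbf F_p)$ ($m\ge0$, $A_0=\mathbf 1$) and $B\in H^3(X;X;\mathbf F_p)$ be quandle classes such that $A_k\cup A_m=\binom{k+m}{k}A_{k+m}$ for all $k,m$, and such that the elements $A_{m_1}\cup B^{e_1}\cup P(A_{m_2}\cup B^{e_2}\cup P(\cdots P(A_{m_s}\cup B^{e_s})\cdots))$, indexed by all sequences $((m_1,e_1),\dots,(m_s,e_s))$ with $s\ge1$, $m_i\ge0$, $e_i\in\{0,1\}$, form a basis of $\bigoplus_nH^n(X;X;\mathbf F_p)$. Then the quandle classes $$A_{m_1}\cup B^{e_1}\cup Q\bigl(A_{m_2}\cup B^{e_2}\cup Q(\cdots Q(A_{m_s}\cup B^{e_s})\cdots)\bigr),$$ indexed by all sequences $((m_1,e_1),\dots,(m_s,e_s))$ with $s\ge 1$, $m_i\ge0$, $e_i\in\{0,1\}$ and $(m_i,e_i)\ne(0,0)$ for all $i\ge2$, are linearly independent over $\mathbf F_p$.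
   Context: $R_p$ is the set $\mathbf Z/p$ with operation $a*b=2b-a$. $C_n(X;X)$ is the free abelian group on symbols $(y;x_1,\dots,x_n)$, $y,x_i\in X$, with $\partial=\sum_{i=1}^n(-1)^i(\delta^0_i-\delta^1_i)$, where $\delta^0_i(y;x_1,\dots,x_n)=(y;x_1,\dots,x_{i-1},x_{i+1},\dots,x_n)$, $\delta^1_i(y;x_1,\dots,x_n)=(y*x_i;x_1*x_i,\dots,x_{i-1}*x_i,x_{i+1},\dots,x_n)$; $H^n(X;X;\mathbf F_p)$ is the cohomology of $C^n(X;X;\mathbf F_p)=\mathrm{Hom}(C_n(X;X),\mathbf F_p)$. The rack complex $C_n(X)$ is the free abelian group on $X^n$ with the same formulas, $y$ omitted; its cohomology is $H^n(X;\mathbf F_p)$. The quandle cohomology $H^n_Q(X;\mathbf F_p)$ is the cohomology of the quotient of $C_n(X)$ by the subcomplex generated by tuples with $x_i=x_{i+1}$ for some $i$. Cup product: for $f\in C^k$, $g\in C^m$, $n=k+m$, $(f\cup g)(z)=(-1)^{km}\sum_A\epsilon(A)f(\delta^0_Az)g(\delta^1_{A'}z)$, the sum over subsets $A=\{a_1<\dots<a_m\}\subseteq\{1,\dots,n\}$ with complement $A'=\{b_1<\dots<b_k\}$; $\epsilon(A)$ is the sign of the permutation sending $(1,\dots,n)$ to $(b_1,\dots,b_k,a_1,\dots,a_m)$, $\delta^0_A=\delta^0_{a_1}\circ\dots\circ\delta^0_{a_m}$, $\delta^1_{A'}=\delta^1_{b_1}\circ\dots\circ\delta^1_{b_k}$.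 The unit is $\mathbf 1$, the class of the constant $0$-cochain $1$. Operators on cochains, all inducing maps on cohomology: $(PF)(x_0;x_1,\dots,x_{k+1})=(-1)^kF(x_1;x_2,\dots,x_{k+1})$ for $F\in C^k(X;X)$; $Q(F)=P(F)+(-1)^{k+1}F\cup\Lambda$ for $F\in C^k(X;X)$, where $\Lambda=P(\mathbf 1)$, i.e. $\Lambda(y;x)=1$; and $\psi\colon C^{n-1}(X;X)\to C^n(X)$, $(\psi F)(x_1,\dots,x_n)=(-1)^{n-1}F(x_1;x_2,\dots,x_n)$. A class $x\in H^n(X;X;\mathbf F_p)$ is a quandle class if $\psi(x)\in H^{n+1}(X;\mathbf F_p)$ lies in the image of the canonical map $H^{n+1}_Q(X;\mathbf F_p)\to H^{n+1}(X;\mathbf F_p)$. Cup products of quandle classes are quandle classes, and $Q$ maps quandle classes to quandle classes. *)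

theory Defs
  imports
    "Berlekamp_Zassenhaus.Finite_Field"
    "HOL-Algebra.Free_Abelian_Groups"
    "HOL-Combinatorics.Permutations"
begin

section \<open>Cohomology of a subcomplex of cochains on free abelian groups\<close>

text \<open>
  The free abelian group on \<open>'s\<close> is \<^typ>\<open>'s \<Rightarrow>\<^sub>0 int\<close>. A homomorphism from it to a ring is given by its
  values on the generators, so cochains are functions \<open>'s \<Rightarrow> 'k\<close>, and \<open>eval_chain F\<close> is the
  homomorphism with values \<open>F\<close>.
\<close>

definition eval_chain :: "('s \<Rightarrow> 'k::ring_1) \<Rightarrow> ('s \<Rightarrow>\<^sub>0 int) \<Rightarrow> 'k" where
  "eval_chain F c = (\<Sum>z\<in>Poly_Mapping.keys c. of_int (Poly_Mapping.lookup c z) * F z)"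

definition coboundary ::
    "(('s \<Rightarrow>\<^sub>0 int) \<Rightarrow> ('s \<Rightarrow>\<^sub>0 int)) \<Rightarrow> ('s \<Rightarrow> 'k::ring_1) \<Rightarrow> ('s \<Rightarrow> 'k)" where
  "coboundary d F = (\<lambda>z. eval_chain F (d (frag_of z)))"

text \<open>
  All degrees are treated at once: \<open>gr\<close> grades the generators, and the elements of
  \<open>graded_cochains gr\<close> are those of the direct sum of the cochain groups of all degrees.
\<close>

definition graded_cochains :: "('s \<Rightarrow> nat) \<Rightarrow> ('s \<Rightarrow> 'k::ring_1) set" where
  "graded_cochains gr = {F. \<exists>N. \<forall>z. F z \<noteq> 0 \<longrightarrow> gr z \<le> N}"

definition homogeneous :: "('s \<Rightarrow> nat) \<Rightarrow> nat \<Rightarrow> ('s \<Rightarrow> 'k::ring_1) set" where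
  "homogeneous gr n = {F. \<forall>z. F z \<noteq> 0 \<longrightarrow> gr z = n}"

definition cocycles ::
    "('s \<Rightarrow> 'k::ring_1) set \<Rightarrow> (('s \<Rightarrow>\<^sub>0 int) \<Rightarrow> ('s \<Rightarrow>\<^sub>0 int)) \<Rightarrow> ('s \<Rightarrow> 'k) set" where
  "cocycles C d = {F \<in> C. coboundary d F = (\<lambda>_. 0)}"

definition cohomologous ::
    "('s \<Rightarrow> 'k::ring_1) set \<Rightarrow> (('s \<Rightarrow>\<^sub>0 int) \<Rightarrow> ('s \<Rightarrow>\<^sub>0 int)) \<Rightarrow> ('s \<Rightarrow> 'k) \<Rightarrow> ('s \<Rightarrow> 'k) \<Rightarrow> bool" where
  "cohomologous C d F G \<longleftrightarrow> F \<in> cocycles C d \<and> G \<in> cocycles C d \<and>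
     (\<exists>H\<in>C. \<forall>z. F z - G z = coboundary d H z)"

definition cochain_module :: "('s \<Rightarrow> 'k::comm_ring_1) set \<Rightarrow> bool" where
  "cochain_module C \<longleftrightarrow> (\<lambda>_. 0) \<in> C \<and> (\<forall>F\<in>C. \<forall>G\<in>C. (\<lambda>z. F z + G z) \<in> C) \<and>
     (\<forall>a. \<forall>F\<in>C. (\<lambda>z. a * F z) \<in> C)"

lemma coboundary_zero: "coboundary d (\<lambda>_. 0) = (\<lambda>_. 0)"
  by (simp add: coboundary_def eval_chain_def)

lemma coboundary_add:
  "coboundary d (\<lambda>z. F z + G z) = (\<lambda>z. coboundary d F z + coboundary d G z)"
  by (simp add: coboundary_def eval_chain_def distrib_left sum.distrib)

lemma coboundary_scale:
  fixes F :: "'s \<Rightarrow> 'k::comm_ring_1"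
  shows "coboundary d (\<lambda>z. a * F z) = (\<lambda>z. a * coboundary d F z)"
  by (simp add: coboundary_def eval_chain_def sum_distrib_left mult.left_commute)

lemma cocycles_zero: "cochain_module C \<Longrightarrow> (\<lambda>_. 0) \<in> cocycles C d"
  by (simp add: cocycles_def cochain_module_def coboundary_zero)

lemma cocycles_add:
  "cochain_module C \<Longrightarrow> F \<in> cocycles C d \<Longrightarrow> G \<in> cocycles C d \<Longrightarrow> (\<lambda>z. F z + G z) \<in> cocycles C d"
  by (auto simp: cocycles_def cochain_module_def coboundary_add)

lemma cocycles_scale:
  "cochain_module C \<Longrightarrow> F \<in> cocycles C d \<Longrightarrow> (\<lambda>z. a * F z) \<in> cocycles C d"
  by (auto simp: cocycles_def cochain_module_def coboundary_scale)

lemma cohomologous_refl: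
  assumes "cochain_module C" "F \<in> cocycles C d"
  shows "cohomologous C d F F"
  using assms unfolding cohomologous_def cochain_module_def
  by (auto intro!: bexI[of _ "\<lambda>_. 0"] simp: coboundary_zero)

lemma cohomologous_add:
  assumes C: "cochain_module C"
    and "cohomologous C d F F'" "cohomologous C d G G'"
  shows "cohomologous C d (\<lambda>z. F z + G z) (\<lambda>z. F' z + G' z)"
proof -
  from assms obtain H K where HK: "H \<in> C" "\<And>z. F z - F' z = coboundary d H z"
      "K \<in> C" "\<And>z. G z - G' z = coboundary d K z"
    by (auto simp: cohomologous_def)
  have "(F z + G z) - (F' z + G' z) = coboundary d (\<lambda>z. H z + K z) z" for z
    unfolding coboundary_add HK(2,4)[symmetric] by simp
  moreover have "(\<lambda>z. H z + K z) \<in> C"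
    using C HK by (auto simp: cochain_module_def)
  ultimately show ?thesis
    using assms by (auto simp: cohomologous_def intro!: cocycles_add)
qed

lemma cohomologous_scale:
  assumes C: "cochain_module C" and "cohomologous C d F F'"
  shows "cohomologous C d (\<lambda>z. a * F z) (\<lambda>z. a * F' z)"
proof -
  from assms obtain H where H: "H \<in> C" "\<And>z. F z - F' z = coboundary d H z"
    by (auto simp: cohomologous_def)
  have "a * F z - a * F' z = coboundary d (\<lambda>z. a * H z) z" for z
    unfolding coboundary_scale H(2)[symmetric] by (simp add: right_diff_distrib)
  moreover have "(\<lambda>z. a * H z) \<in> C"
    using C H by (auto simp: cochain_module_def)
  ultimately show ?thesis
    using assms by (auto simp: cohomologous_def intro!: cocycles_scale)
qed

lemma part_equivp_cohomologous:
  assumes C: "cochain_module C"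
  shows "part_equivp (cohomologous C d)"
proof (rule part_equivpI)
  show "\<exists>F. cohomologous C d F F"
    using cohomologous_refl[OF C cocycles_zero[OF C]] by blast
next
  show "symp (cohomologous C d)"
  proof (rule sympI)
    fix F G assume FG: "cohomologous C d F G"
    then obtain H where H: "H \<in> C" "\<And>z. F z - G z = coboundary d H z"
      by (auto simp: cohomologous_def)
    have "G z - F z = coboundary d (\<lambda>z. (-1) * H z) z" for z
      unfolding coboundary_scale H(2)[symmetric] by simp
    moreover have "(\<lambda>z. (-1) * H z) \<in> C"
      using C H(1) unfolding cochain_module_def by blast
    ultimately show "cohomologous C d G F"
      using FG by (auto simp: cohomologous_def)
  qed
next
  show "transp (cohomologous C d)"
  proof (rule transpI)
    fix F G K assume FG: "cohomologous C d F G" and GK: "cohomologous C d G K"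
    then obtain H H' where H: "H \<in> C" "\<And>z. F z - G z = coboundary d H z"
        "H' \<in> C" "\<And>z. G z - K z = coboundary d H' z"
      by (auto simp: cohomologous_def)
    have "F z - K z = coboundary d (\<lambda>z. H z + H' z) z" for z
      unfolding coboundary_add H(2,4)[symmetric] by simp
    moreover have "(\<lambda>z. H z + H' z) \<in> C"
      using C H by (auto simp: cochain_module_def)
    ultimately show "cohomologous C d F K"
      using FG GK by (auto simp: cohomologous_def)
  qed
qed

lemma cochain_module_graded: "cochain_module (graded_cochains gr)"
  unfolding cochain_module_def graded_cochains_def
proof (intro conjI ballI allI; clarsimp)
  fix F G :: "'a \<Rightarrow> 'b" and M N
  assume "\<forall>z. F z \<noteq> 0 \<longrightarrow> gr z \<le> M" "\<forall>z. G z \<noteq> 0 \<longrightarrow> gr z \<le> N"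
  then have "\<forall>z. F z + G z \<noteq> 0 \<longrightarrow> gr z \<le> max M N"
    by (metis add.right_neutral le_max_iff_disj)
  then show "\<exists>K. \<forall>z. F z + G z \<noteq> 0 \<longrightarrow> gr z \<le> K" ..
next
  fix F :: "'a \<Rightarrow> 'b" and a N
  assume "\<forall>z. F z \<noteq> 0 \<longrightarrow> gr z \<le> N"
  then have "\<forall>z. a * F z \<noteq> 0 \<longrightarrow> gr z \<le> N"
    by (metis mult_zero_right)
  then show "\<exists>K. \<forall>z. a * F z \<noteq> 0 \<longrightarrow> gr z \<le> K" ..
qed


section \<open>The chain complexes of the dihedral quandle\<close>

text \<open>
  \<^typ>\<open>'p mod_ring\<close> is the ring of integers modulo \<open>CARD('p)\<close>. It serves both as the underlying set
  of the dihedral quandle (under the name \<open>'p dihedral\<close>) and as the coefficient field.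
\<close>

type_synonym 'p dihedral = "'p mod_ring"
type_synonym 'p symbol = "'p dihedral \<times> 'p dihedral list"

definition dihedral_op :: "'p::prime_card dihedral \<Rightarrow> 'p dihedral \<Rightarrow> 'p dihedral"
    (infixl "\<triangleright>" 70) where
  "a \<triangleright> b = 2 * b - a"

text \<open>The face maps on tuples; as in the usual notation, the index \<open>i\<close> runs from 1 to the length.\<close>

definition tuple_face0 :: "nat \<Rightarrow> 'p::prime_card dihedral list \<Rightarrow> 'p dihedral list" where
  "tuple_face0 i xs = take (i - 1) xs @ drop i xs"

definition tuple_face1 :: "nat \<Rightarrow> 'p::prime_card dihedral list \<Rightarrow> 'p dihedral list" where
  "tuple_face1 i xs = map (\<lambda>x. x \<triangleright> xs ! (i - 1)) (take (i - 1) xs) @ drop i xs"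

definition face0 :: "nat \<Rightarrow> 'p::prime_card symbol \<Rightarrow> 'p symbol" where
  "face0 i z = (fst z, tuple_face0 i (snd z))"

definition face1 :: "nat \<Rightarrow> 'p::prime_card symbol \<Rightarrow> 'p symbol" where
  "face1 i z = (fst z \<triangleright> snd z ! (i - 1), tuple_face1 i (snd z))"

abbreviation symbol_degree :: "'p symbol \<Rightarrow> nat" where
  "symbol_degree z \<equiv> length (snd z)"

definition symbol_boundary ::
    "('p::prime_card symbol \<Rightarrow>\<^sub>0 int) \<Rightarrow> ('p symbol \<Rightarrow>\<^sub>0 int)" where
  "symbol_boundary = frag_extend (\<lambda>z. \<Sum>i = 1..symbol_degree z.
     frag_cmul ((-1) ^ i) (frag_of (face0 i z) - frag_of (face1 i z)))"

definition rack_boundary ::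
    "('p::prime_card dihedral list \<Rightarrow>\<^sub>0 int) \<Rightarrow> ('p dihedral list \<Rightarrow>\<^sub>0 int)" where
  "rack_boundary = frag_extend (\<lambda>xs. \<Sum>i = 1..length xs.
     frag_cmul ((-1) ^ i) (frag_of (tuple_face0 i xs) - frag_of (tuple_face1 i xs)))"

definition degenerate_tuples :: "'p dihedral list set" where
  "degenerate_tuples = {xs. \<exists>i. Suc i < length xs \<and> xs ! i = xs ! Suc i}"

text \<open>Cochains on the quotient by the degenerate subcomplex are the cochains vanishing on it.\<close>

definition quandle_cochains :: "('p::prime_card dihedral list \<Rightarrow> 'p mod_ring) set" where
  "quandle_cochains = {F \<in> graded_cochains length.
     \<forall>c \<in> carrier (free_Abelian_group degenerate_tuples). eval_chain F c = 0}"

lemma cochain_module_quandle: "cochain_module quandle_cochains"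
  using cochain_module_graded[where ?'a = "'a dihedral list" and ?'b = "'a mod_ring", of length]
  by (auto simp: cochain_module_def quandle_cochains_def eval_chain_def distrib_left sum.distrib
      mult.left_commute sum_distrib_left [symmetric])


section \<open>Cohomology groups\<close>

text \<open>
  \<open>symbol_cohomology\<close>, \<open>rack_cohomology\<close> and \<open>quandle_cohomology\<close> are the direct sums over all
  \<open>n\<close> of $H^n(X;X;\mathbf F_p)$, $H^n(X;\mathbf F_p)$ and $H^n_Q(X;\mathbf F_p)$ for $X = R_p$.
\<close>

quotient_type 'p symbol_cohomology = "'p::prime_card symbol \<Rightarrow> 'p mod_ring" /
    partial: "cohomologous (graded_cochains symbol_degree) symbol_boundary"
  by (rule part_equivp_cohomologous[OF cochain_module_graded])

quotient_type 'p rack_cohomology = "'p::prime_card dihedral list \<Rightarrow> 'p mod_ring" /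
    partial: "cohomologous (graded_cochains length) rack_boundary"
  by (rule part_equivp_cohomologous[OF cochain_module_graded])

quotient_type 'p quandle_cohomology = "'p::prime_card dihedral list \<Rightarrow> 'p mod_ring" /
    partial: "cohomologous quandle_cochains rack_boundary"
  by (rule part_equivp_cohomologous[OF cochain_module_quandle])

(* Otherwise the liftings below would descend to the integers representing the coefficients. *)
lifting_forget mod_ring.lifting

definition H_symbol :: "nat \<Rightarrow> 'p::prime_card symbol_cohomology set" where
  "H_symbol n = abs_symbol_cohomology `
     (cocycles (graded_cochains symbol_degree) symbol_boundary \<inter> homogeneous symbol_degree n)"

definition H_quandle :: "nat \<Rightarrow> 'p::prime_card quandle_cohomology set" where
  "H_quandle n = abs_quandle_cohomology `
     (cocycles quandle_cochains rack_boundary \<inter> homogeneous length n)"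

instantiation symbol_cohomology :: (prime_card) ab_group_add
begin

lift_definition zero_symbol_cohomology :: "'a symbol_cohomology" is "\<lambda>_. 0"
  by (intro cohomologous_refl cocycles_zero cochain_module_graded)

lift_definition plus_symbol_cohomology ::
    "'a symbol_cohomology \<Rightarrow> 'a symbol_cohomology \<Rightarrow> 'a symbol_cohomology" is
  "\<lambda>F G z. F z + G z"
  by (intro cohomologous_add cochain_module_graded)

lift_definition uminus_symbol_cohomology :: "'a symbol_cohomology \<Rightarrow> 'a symbol_cohomology" is
  "\<lambda>F z. (-1) * F z"
  by (intro cohomologous_scale cochain_module_graded)

definition minus_symbol_cohomology ::
    "'a symbol_cohomology \<Rightarrow> 'a symbol_cohomology \<Rightarrow> 'a symbol_cohomology" where
  "minus_symbol_cohomology x y = x + (- y)"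

instance
proof
  fix x y z :: "'a symbol_cohomology"
  show "x + y + z = x + (y + z)"
    by transfer (simp only: add.assoc, intro cohomologous_add cochain_module_graded)
  show "x + y = y + x"
    by transfer (subst add.commute, intro cohomologous_add cochain_module_graded)
  show "0 + x = x"
    by transfer simp
  show "- x + x = 0"
    by transfer (simp, intro cohomologous_refl cocycles_zero cochain_module_graded)
  show "x - y = x + - y"
    by (rule minus_symbol_cohomology_def)
qed

end

lift_definition scale_cohomology ::
    "'p::prime_card mod_ring \<Rightarrow> 'p symbol_cohomology \<Rightarrow> 'p symbol_cohomology" (infixr "*\<^sub>H" 75) is
  "\<lambda>a F z. a * F z"
  by (intro cohomologous_scale cochain_module_graded)

lemma vector_space_scale_cohomology:
  "vector_space (scale_cohomology :: 'p::prime_card mod_ring \<Rightarrow> _)"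
proof
  fix a b :: "'p mod_ring" and x y :: "'p symbol_cohomology"
  show "a *\<^sub>H (x + y) = a *\<^sub>H x + a *\<^sub>H y"
    by transfer (simp only: distrib_left, intro cohomologous_add cohomologous_scale cochain_module_graded)
  show "(a + b) *\<^sub>H x = a *\<^sub>H x + b *\<^sub>H x"
    by transfer (simp only: distrib_right, intro cohomologous_add cohomologous_scale cochain_module_graded)
  show "a *\<^sub>H b *\<^sub>H x = (a * b) *\<^sub>H x"
    by transfer (simp only: mult.assoc, intro cohomologous_scale cochain_module_graded)
  show "1 *\<^sub>H x = x"
    by transfer simp
qed

interpretation cohomology: vector_space scale_cohomology
  by (rule vector_space_scale_cohomology)


section \<open>Operations\<close>

text \<open>
  The operations below are given by formulas on cochains of each degree; on a sum of cochains of
  several degrees they act componentwise.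
\<close>

text \<open>Sign of the permutation $(1,\dots,n) \mapsto (b_1,\dots,b_k,a_1,\dots,a_m)$.\<close>

definition shuffle_sign :: "nat \<Rightarrow> nat set \<Rightarrow> int" where
  "shuffle_sign n A = sign (\<lambda>i. if i \<in> {1..n}
     then (sorted_list_of_set ({1..n} - A) @ sorted_list_of_set A) ! (i - 1) else i)"

definition faces0 :: "nat set \<Rightarrow> 'p::prime_card symbol \<Rightarrow> 'p symbol" where
  "faces0 A = foldr face0 (sorted_list_of_set A)"

definition faces1 :: "nat set \<Rightarrow> 'p::prime_card symbol \<Rightarrow> 'p symbol" where
  "faces1 A = foldr face1 (sorted_list_of_set A)"

text \<open>
  For \<open>f\<close> of degree \<open>k\<close>, \<open>g\<close> of degree \<open>m\<close> and \<open>z\<close> of degree \<open>k + m\<close> only the sets \<open>A\<close> with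
  \<open>card A = m\<close> contribute, since otherwise \<open>faces0 A z\<close> does not have degree \<open>k\<close>.
\<close>

definition cup ::
    "('p::prime_card symbol \<Rightarrow> 'p mod_ring) \<Rightarrow> ('p symbol \<Rightarrow> 'p mod_ring) \<Rightarrow>
     ('p symbol \<Rightarrow> 'p mod_ring)" where
  "cup f g z = (let n = symbol_degree z in
     \<Sum>A \<in> Pow {1..n}. (-1) ^ ((n - card A) * card A) * of_int (shuffle_sign n A) *
       f (faces0 A z) * g (faces1 ({1..n} - A) z))"

definition one_cochain :: "'p::prime_card symbol \<Rightarrow> 'p mod_ring" where
  "one_cochain z = (if symbol_degree z = 0 then 1 else 0)"

fun P_cochain ::
    "('p::prime_card symbol \<Rightarrow> 'p mod_ring) \<Rightarrow> ('p symbol \<Rightarrow> 'p mod_ring)" where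
  "P_cochain F (y, []) = 0"
| "P_cochain F (y, x # xs) = (-1) ^ length xs * F (x, xs)"

text \<open>If \<open>F\<close> has degree \<open>k\<close>, then the summands below are supported in degree \<open>k + 1\<close>.\<close>

definition Q_cochain ::
    "('p::prime_card symbol \<Rightarrow> 'p mod_ring) \<Rightarrow> ('p symbol \<Rightarrow> 'p mod_ring)" where
  "Q_cochain F z = P_cochain F z + (-1) ^ symbol_degree z * cup F (P_cochain one_cochain) z"

fun psi_cochain ::
    "('p::prime_card symbol \<Rightarrow> 'p mod_ring) \<Rightarrow> ('p dihedral list \<Rightarrow> 'p mod_ring)" where
  "psi_cochain F [] = 0"
| "psi_cochain F (x # xs) = (-1) ^ length xs * F (x, xs)"

text \<open>
  All these operations send cocycles to cocycles and respect cohomology, so that on cohomology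
  they are computed on an arbitrary representative. For cochains of degrees \<open>k\<close> and \<open>m\<close> the product
  rule reads \<open>\<delta>(f \<union> g) = (-1)\<^sup>m \<delta>f \<union> g + f \<union> \<delta>g\<close>, while \<open>P\<close>, \<open>Q\<close> and \<open>\<psi>\<close> commute with \<open>\<delta>\<close>.
\<close>

instantiation symbol_cohomology :: (prime_card) "{one, times}"
begin

definition one_symbol_cohomology :: "'a symbol_cohomology" where
  "1 = abs_symbol_cohomology one_cochain"

definition times_symbol_cohomology ::
    "'a symbol_cohomology \<Rightarrow> 'a symbol_cohomology \<Rightarrow> 'a symbol_cohomology" where
  "x * y = abs_symbol_cohomology (cup (rep_symbol_cohomology x) (rep_symbol_cohomology y))"

instance ..

end

instance symbol_cohomology :: (prime_card) power ..

definition P_op :: "'p::prime_card symbol_cohomology \<Rightarrow> 'p symbol_cohomology" where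
  "P_op x = abs_symbol_cohomology (P_cochain (rep_symbol_cohomology x))"

definition Q_op :: "'p::prime_card symbol_cohomology \<Rightarrow> 'p symbol_cohomology" where
  "Q_op x = abs_symbol_cohomology (Q_cochain (rep_symbol_cohomology x))"

definition psi :: "'p::prime_card symbol_cohomology \<Rightarrow> 'p rack_cohomology" where
  "psi x = abs_rack_cohomology (psi_cochain (rep_symbol_cohomology x))"

definition canonical_map :: "'p::prime_card quandle_cohomology \<Rightarrow> 'p rack_cohomology" where
  "canonical_map x = abs_rack_cohomology (rep_quandle_cohomology x)"

definition quandle_class :: "nat \<Rightarrow> 'p::prime_card symbol_cohomology \<Rightarrow> bool" where
  "quandle_class n x \<longleftrightarrow> x \<in> H_symbol n \<and> psi x \<in> canonical_map ` H_quandle (Suc n)"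


section \<open>Families of iterated products\<close>

definition independent_family :: "'i set \<Rightarrow> ('i \<Rightarrow> 'p::prime_card symbol_cohomology) \<Rightarrow> bool" where
  "independent_family I v \<longleftrightarrow> inj_on v I \<and> cohomology.independent (v ` I)"

definition basis_family :: "'i set \<Rightarrow> ('i \<Rightarrow> 'p::prime_card symbol_cohomology) \<Rightarrow> bool" where
  "basis_family I v \<longleftrightarrow> independent_family I v \<and> cohomology.span (v ` I) = UNIV"

text \<open>\<open>iterated_product T A B [(m\<^sub>1,e\<^sub>1),\<dots>,(m\<^sub>s,e\<^sub>s)]\<close> is
  \<open>A m\<^sub>1 * B ^ e\<^sub>1 * T (A m\<^sub>2 * B ^ e\<^sub>2 * T (\<dots> T (A m\<^sub>s * B ^ e\<^sub>s)\<dots>))\<close>; it is only used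
  for nonempty sequences.\<close>

fun iterated_product ::
    "('p::prime_card symbol_cohomology \<Rightarrow> 'p symbol_cohomology) \<Rightarrow> (nat \<Rightarrow> 'p symbol_cohomology) \<Rightarrow>
     'p symbol_cohomology \<Rightarrow> (nat \<times> nat) list \<Rightarrow> 'p symbol_cohomology" where
  "iterated_product T A B [] = 1"
| "iterated_product T A B [(m, e)] = A m * B ^ e"
| "iterated_product T A B ((m, e) # s) = A m * B ^ e * T (iterated_product T A B s)"

definition index_sequences :: "(nat \<times> nat) list set" where
  "index_sequences = {s. s \<noteq> [] \<and> (\<forall>(m, e) \<in> set s. e \<in> {0, 1})}"

end

theory Submission
  imports Defs "Jordan_Normal_Form.Determinant"
begin

text \<open>
  Call a pair \<open>(m, e)\<close> a letter, standing for \<open>A\<^sub>m \<union> B\<^sup>e\<close>, and call a sequence of letters a word,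
  standing for the iterated product built with \<open>P\<close>. The words form a basis, and \<open>P\<close> prefixes a word
  with the letter \<open>(0, 0)\<close>. Let \<open>Z\<close> be the span of the degenerate words, those with \<open>(0, 0)\<close> behind
  their first letter. The iterated product built with \<open>Q\<close> turns out to be congruent modulo \<open>Z\<close> to
  the one built with \<open>P\<close>. The nondegenerate words are a basis modulo \<open>Z\<close>, so the products built
  with \<open>Q\<close> over them are independent (\<open>independent_family_perturbation\<close>).

  The congruence (\<open>Q_word_minus_P_word\<close>) rests on three facts. First, \<open>Q x = P x - x' \<union> \<Lambda>\<close>, where \<open>x'\<close>
  is \<open>x\<close> with its component of degree \<open>k\<close> multiplied by \<open>(-1)\<^sup>k\<close> (\<open>Q_op_eq\<close>). Second, there is a
  Rota--Baxter identity \<open>P x \<union> \<Lambda> = P (x \<union> \<Lambda>) - P (P x')\<close> (\<open>P_op_times_Lambda\<close>); it says that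
  multiplication by \<open>\<Lambda>\<close> inserts the letter \<open>(0, 0)\<close> behind the first letter in all possible ways, so
  that \<open>y \<union> \<Lambda>\<close> lies in \<open>Z\<close> for every class \<open>y\<close> (\<open>times_Lambda\<close>). Third, the product is associative:
  for a letter \<open>v\<close> the classes \<open>v \<union> Q x\<close> and \<open>v \<union> P x\<close> differ by \<open>(v \<union> x') \<union> \<Lambda>\<close>, which is in \<open>Z\<close>.

  On cochains all identities are obtained from one recursion (\<open>cup_append\<close>), which evaluates a cup
  product on a symbol by splitting off its last coordinate. Associativity, the unit and the product
  rule \<open>\<delta>(f \<union> g) = \<delta>f \<union> grade_sign g + f \<union> \<delta>g\<close> follow from it by induction on the degree of the symbol, and
  the product rule makes the product well defined on cohomology.
\<close>

section \<open>Symbols and cochains built up from the last coordinate\<close>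

definition append_coordinate :: "'p::prime_card symbol \<Rightarrow> 'p dihedral \<Rightarrow> 'p symbol" where
  "append_coordinate z x = (fst z, snd z @ [x])"

definition act :: "'p::prime_card dihedral \<Rightarrow> 'p symbol \<Rightarrow> 'p symbol" where
  "act x z = (fst z \<triangleright> x, map (\<lambda>a. a \<triangleright> x) (snd z))"

lemma dihedral_distrib: "(a \<triangleright> b) \<triangleright> c = (a \<triangleright> c) \<triangleright> (b \<triangleright> c)"
  by (simp add: dihedral_op_def algebra_simps)

lemma degree_append_coordinate [simp]: "symbol_degree (append_coordinate z x) = Suc (symbol_degree z)"
  by (simp add: append_coordinate_def)

lemma degree_act [simp]: "symbol_degree (act x z) = symbol_degree z"
  by (simp add: act_def)

lemma act_append_coordinate:
  "act x (append_coordinate z w) = append_coordinate (act x z) (w \<triangleright> x)"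
  by (simp add: act_def append_coordinate_def)

lemma act_act: "act x (act w z) = act (w \<triangleright> x) (act x z)"
  by (simp add: act_def dihedral_distrib[of _ w x])

text \<open>
  Inductions run over the last coordinate, because the face \<open>\<delta>\<^sup>1\<^sub>i\<close> changes the coordinates in front of
  the \<open>i\<close>-th but leaves those behind it alone.
\<close>

lemma symbol_induct [case_names Nil append]:
  assumes "\<And>y. Pr (y, [])" and "\<And>z x. Pr z \<Longrightarrow> Pr (append_coordinate z x)"
  shows "Pr z"
proof -
  have "Pr (y, xs)" for y xs
    by (induction xs rule: rev_induct) (use assms in \<open>auto simp: append_coordinate_def\<close>)
  then show ?thesis by (cases z) (simp only:)
qed

lemma face0_append:
  assumes "i \<in> {1..symbol_degree z}"
  shows "face0 i (append_coordinate z x) = append_coordinate (face0 i z) x"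
  using assms by (simp add: face0_def tuple_face0_def append_coordinate_def)

lemma face1_append:
  assumes "i \<in> {1..symbol_degree z}"
  shows "face1 i (append_coordinate z x) = append_coordinate (face1 i z) x"
  using assms by (auto simp: face1_def tuple_face1_def append_coordinate_def nth_append)

lemma face0_append_last: "face0 (Suc (symbol_degree z)) (append_coordinate z x) = z"
  by (simp add: face0_def tuple_face0_def append_coordinate_def)

text \<open>
  Acting by the last coordinate on everything in front of it is itself a face map; this is where the
  action enters the recursion for the product.
\<close>

lemma face1_append_last: "face1 (Suc (symbol_degree z)) (append_coordinate z x) = act x z"
  by (simp add: face1_def tuple_face1_def append_coordinate_def act_def)

lemma degree_face0: "i \<in> {1..symbol_degree z} \<Longrightarrow> symbol_degree (face0 i z) = symbol_degree z - 1"
  by (auto simp: face0_def tuple_face0_def min_def)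

lemma degree_face1: "i \<in> {1..symbol_degree z} \<Longrightarrow> symbol_degree (face1 i z) = symbol_degree z - 1"
  by (auto simp: face1_def tuple_face1_def min_def)

lemma face0_act:
  "i \<in> {1..symbol_degree z} \<Longrightarrow> face0 i (act x z) = act x (face0 i z)"
  by (simp add: face0_def tuple_face0_def act_def take_map drop_map)

lemma face1_act:
  "i \<in> {1..symbol_degree z} \<Longrightarrow> face1 i (act x z) = act x (face1 i z)"
  by (auto simp: face1_def tuple_face1_def act_def take_map drop_map dihedral_distrib[of _ _ x])

text \<open>
  In a composition of faces the largest index acts first, so an index in the range of the original
  symbol is still in range when its face ks taken.
\<close>

lemma foldr_faces:
  fixes face :: "nat \<Rightarrow> 'p::prime_card symbol \<Rightarrow> 'p symbol"
  assumes face: "\<And>i z. i \<in> {1..symbol_degree z} \<Longrightarrow> symbol_degree (face i z) = symbol_degree z - 1"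
    and "sorted_wrt (<) ks" and "set ks \<subseteq> {1..symbol_degree z}"
  shows "symbol_degree (foldr face ks z) = symbol_degree z - length ks"
    and "\<lbrakk>\<And>i z. i \<in> {1..symbol_degree z} \<Longrightarrow> face i (h z) = h (face i z)\<rbrakk>
      \<Longrightarrow> foldr face ks (h z) = h (foldr face ks z)"
proof -
  have "symbol_degree (foldr face ks z) = symbol_degree z - length ks \<and>
    ((\<forall>i z. i \<in> {1..symbol_degree z} \<longrightarrow> face i (h z) = h (face i z)) \<longrightarrow>
      foldr face ks (h z) = h (foldr face ks z))"
    using assms(2,3)
  proof (induction ks)
    case Nil
    then show ?case by simp
  next
    case (Cons i js)
    have "set js \<subseteq> {Suc i..symbol_degree z}"
      using Cons.prems by force
    then have "card (set js) \<le> card {Suc i..symbol_degree z}"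
      by (intro card_mono) auto
    moreover have "card (set js) = length js"
      using Cons.prems by (intro distinct_card) (simp add: strict_sorted_iff)
    moreover have deg: "symbol_degree (foldr face js z) = symbol_degree z - length js"
      using Cons by auto
    ultimately have i: "i \<in> {1..symbol_degree (foldr face js z)}"
      using Cons.prems by auto
    show ?case
    proof (intro conjI impI)
      show "symbol_degree (foldr face (i # js) z) = symbol_degree z - length (i # js)"
        using face[OF i] deg by simp
    next
      assume comm: "\<forall>i z. i \<in> {1..symbol_degree z} \<longrightarrow> face i (h z) = h (face i z)"
      then have "foldr face js (h z) = h (foldr face js z)"
        using Cons by auto
      moreover have "face i (h (foldr face js z)) = h (face i (foldr face js z))"
        using comm i by blast
      ultimately show "foldr face (i # js) (h z) = h (foldr face (i # js) z)"
        by simp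
    qed
  qed
  then show "symbol_degree (foldr face ks z) = symbol_degree z - length ks"
    and "\<lbrakk>\<And>i z. i \<in> {1..symbol_degree z} \<Longrightarrow> face i (h z) = h (face i z)\<rbrakk>
      \<Longrightarrow> foldr face ks (h z) = h (foldr face ks z)"
    by auto
qed

lemma sorted_list_of_set_subset:
  assumes "S \<subseteq> {1..n::nat}"
  shows "sorted_wrt (<) (sorted_list_of_set S)" "set (sorted_list_of_set S) = S"
    "length (sorted_list_of_set S) = card S"
  using finite_subset[OF assms] by auto

lemma degree_faces0:
  "S \<subseteq> {1..symbol_degree z} \<Longrightarrow> symbol_degree (faces0 S z) = symbol_degree z - card S"
  unfolding faces0_def
  by (subst foldr_faces(1)) (auto simp: degree_face0 sorted_list_of_set_subset)

lemma degree_faces1: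
  "S \<subseteq> {1..symbol_degree z} \<Longrightarrow> symbol_degree (faces1 S z) = symbol_degree z - card S"
  unfolding faces1_def
  by (subst foldr_faces(1)) (auto simp: degree_face1 sorted_list_of_set_subset)

lemma faces0_append:
  assumes "S \<subseteq> {1..symbol_degree z}"
  shows "faces0 S (append_coordinate z x) = append_coordinate (faces0 S z) x"
  unfolding faces0_def
  by (rule foldr_faces(2)[where h = "\<lambda>z. append_coordinate z x"])
    (use assms in \<open>auto simp: degree_face0 face0_append sorted_list_of_set_subset\<close>)

lemma faces1_append:
  assumes "S \<subseteq> {1..symbol_degree z}"
  shows "faces1 S (append_coordinate z x) = append_coordinate (faces1 S z) x"
  unfolding faces1_def
  by (rule foldr_faces(2)[where h = "\<lambda>z. append_coordinate z x"])
    (use assms in \<open>auto simp: degree_face1 face1_append sorted_list_of_set_subset\<close>)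

lemma faces1_act:
  assumes "S \<subseteq> {1..symbol_degree z}"
  shows "faces1 S (act x z) = act x (faces1 S z)"
  unfolding faces1_def
  by (rule foldr_faces(2)[where h = "act x"])
    (use assms in \<open>auto simp: degree_face1 face1_act sorted_list_of_set_subset\<close>)

lemma sorted_list_of_set_insert_last:
  assumes "S \<subseteq> {1..n::nat}"
  shows "sorted_list_of_set (insert (Suc n) S) = sorted_list_of_set S @ [Suc n]"
proof (rule strict_sorted_equal)
  have fin: "finite S" using assms by (rule finite_subset) simp
  show "sorted_wrt (<) (sorted_list_of_set S @ [Suc n])"
    using assms fin by (force simp: sorted_wrt_append)
  show "set (sorted_list_of_set (insert (Suc n) S)) = set (sorted_list_of_set S @ [Suc n])"
    using fin by (subst set_sorted_list_of_set) simp_all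
qed simp

lemma faces0_append_last:
  assumes "S \<subseteq> {1..symbol_degree z}"
  shows "faces0 (insert (Suc (symbol_degree z)) S) (append_coordinate z x) = faces0 S z"
  unfolding faces0_def sorted_list_of_set_insert_last[OF assms] by (simp add: face0_append_last)

lemma faces1_append_last:
  assumes "S \<subseteq> {1..symbol_degree z}"
  shows "faces1 (insert (Suc (symbol_degree z)) S) (append_coordinate z x) = act x (faces1 S z)"
proof -
  have "faces1 (insert (Suc (symbol_degree z)) S) (append_coordinate z x) = faces1 S (act x z)"
    unfolding faces1_def sorted_list_of_set_insert_last[OF assms] by (simp add: face1_append_last)
  then show ?thesis using faces1_act[OF assms] by simp
qed


section \<open>The cup product\<close>

text \<open>
  The exponent \<open>k m\<close> turns the shuffle sign into the parity of the pairs \<open>b < a\<close> with \<open>a\<close> in \<open>S\<close> and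
  \<open>b\<close> outside: \<open>n + 1\<close> contributes to it as an element of \<open>S\<close> but not as an element of the
  complement.
\<close>

definition cup_sign :: "nat \<Rightarrow> nat set \<Rightarrow> 'k::ring_1" where
  "cup_sign n S = (-1) ^ ((n - card S) * card S) * of_int (shuffle_sign n S)"

lemma shuffle_permutes:
  assumes "S \<subseteq> {1..n}"
  shows "(\<lambda>i. if i \<in> {1..n} then (sorted_list_of_set ({1..n} - S) @ sorted_list_of_set S) ! (i - 1)
     else i) permutes {1..n}" (is "?p permutes _")
proof (rule bij_imp_permutes)
  let ?xs = "sorted_list_of_set ({1..n} - S) @ sorted_list_of_set S"
  have fin: "finite S" using assms by (rule finite_subset) simp
  have "card ({1..n} - S) + card S = n"
    using assms fin card_mono[OF _ assms] by (simp add: card_Diff_subset)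
  then have xs: "distinct ?xs" "set ?xs = {1..n}" "length ?xs = n"
    using assms fin by auto
  have "bij_betw (\<lambda>i. i - 1) {1..n} {..<n}"
    by (rule bij_betwI[where g = Suc]) auto
  from bij_betw_trans[OF this bij_betw_nth[OF xs(1), of "{..<n}" "{1..n}"]]
  have "bij_betw (\<lambda>i. ?xs ! (i - 1)) {1..n} {1..n}"
    using xs by (simp add: comp_def)
  then show "bij_betw ?p {1..n} {1..n}"
    by (rule bij_betw_cong[THEN iffD1, rotated]) simp
qed auto

lemma shuffle_sign_Suc_insert:
  assumes "S \<subseteq> {1..n}"
  shows "shuffle_sign (Suc n) (insert (Suc n) S) = shuffle_sign n S"
proof -
  have fin: "finite S" using assms by (rule finite_subset) simp
  have D: "{1..Suc n} - insert (Suc n) S = {1..n} - S" using assms by auto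
  define xs where "xs = sorted_list_of_set ({1..n} - S) @ sorted_list_of_set S"
  have len: "length xs = n"
    using assms fin card_mono[OF _ assms] by (simp add: xs_def card_Diff_subset)
  have "(if i \<in> {1..Suc n} then (xs @ [Suc n]) ! (i - 1) else i) =
      (if i \<in> {1..n} then xs ! (i - 1) else i)" for i
    using len by (cases "i = Suc n") (auto simp: nth_append)
  then show ?thesis
    unfolding shuffle_sign_def D sorted_list_of_set_insert_last[OF assms] append_assoc[symmetric]
      xs_def by presburger
qed

text \<open>
  If \<open>n + 1\<close> is not in \<open>S\<close>, it is inserted in front of the elements of \<open>S\<close> and has to be moved past
  each of them.
\<close>

lemma shuffle_sign_Suc:
  assumes "S \<subseteq> {1..n}"
  shows "shuffle_sign (Suc n) S = (-1) ^ card S * shuffle_sign n S"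
proof -
  have fin: "finite S" using assms by (rule finite_subset) simp
  have cardS: "card S \<le> n" using card_mono[OF _ assms] by simp
  define bs where "bs = sorted_list_of_set ({1..n} - S)"
  define as where "as = sorted_list_of_set S"
  have D: "sorted_list_of_set ({1..Suc n} - S) = bs @ [Suc n]"
  proof -
    have "{1..Suc n} - S = insert (Suc n) ({1..n} - S)" using assms by auto
    then show ?thesis using sorted_list_of_set_insert_last[of "{1..n} - S" n] by (simp add: bs_def)
  qed
  define p where "p = (\<lambda>i. if i \<in> {1..n} then (bs @ as) ! (i - 1) else i)"
  define k where "k = n - card S"
  have len: "length bs = k" "length as = n - k" "k \<le> n"
    using fin cardS assms by (auto simp: card_Diff_subset k_def bs_def as_def)
  have p: "p permutes {1..n}"
    unfolding p_def bs_def as_def by (rule shuffle_permutes[OF assms])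
  then have p_le: "p i \<le> n \<longleftrightarrow> i \<le> n" for i
    using permutes_in_image[OF p, of i] by (auto simp: p_def)
  have "(\<lambda>i. if i \<in> {1..Suc n} then ((bs @ [Suc n]) @ as) ! (i - 1) else i) =
      permutation_insert (Suc k) (Suc n) p" (is "?q = _")
  proof
    fix i
    show "?q i = permutation_insert (Suc k) (Suc n) p i"
    proof (cases i "Suc k" rule: linorder_cases)
      case less
      then have "p i \<le> n" "?q i = p i"
        using len p_le[of i] by (auto simp: p_def nth_append)
      then show ?thesis using less by (simp add: permutation_insert_expand)
    next
      case equal
      then show ?thesis
        using len by (simp add: nth_append permutation_insert_expand)
    next
      case greater
      show ?thesis
      proof (cases "i \<le> Suc n")
        case True
        then have "p (i - 1) \<le> n" "?q i = p (i - 1)"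
          using len p_le[of "i - 1"] greater by (auto simp: p_def nth_append nth_Cons')
        then show ?thesis using greater by (simp add: permutation_insert_expand)
      next
        case False
        then have "p (i - 1) = i - 1" "?q i = i" by (auto simp: p_def)
        moreover have "\<not> i - 1 < Suc n" using False by simp
        ultimately show ?thesis using greater by (simp add: permutation_insert_expand)
      qed
    qed
  qed
  then have "shuffle_sign (Suc n) S = sign (permutation_insert (Suc k) (Suc n) p)"
    unfolding shuffle_sign_def D as_def[symmetric] by (simp only:)
  also have "\<dots> = (-1) ^ (Suc k + Suc n) * sign p"
    using signof_permutation_insert[of p "Suc n" "Suc k" "Suc n", where 'a = int]
      permutes_subset[OF p, of "{0..<Suc n}"] len by (auto simp: subset_iff)
  also have "(-1) ^ (Suc k + Suc n) = (-1 :: int) ^ card S"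
    using cardS by (simp add: k_def uminus_power_if)
  also have "sign p = shuffle_sign n S"
    unfolding p_def bs_def as_def shuffle_sign_def ..
  finally show ?thesis .
qed

lemma cup_sign_Suc_insert:
  assumes "S \<subseteq> {1..n}"
  shows "cup_sign (Suc n) (insert (Suc n) S) = (-1) ^ (n - card S) * (cup_sign n S :: 'k::comm_ring_1)"
proof -
  have "finite S" "Suc n \<notin> S" using assms finite_subset[OF assms] by auto
  then show ?thesis
    by (simp add: cup_sign_def shuffle_sign_Suc_insert[OF assms] power_add mult.assoc)
qed

lemma cup_sign_Suc:
  assumes "S \<subseteq> {1..n}"
  shows "cup_sign (Suc n) S = (cup_sign n S :: 'k::comm_ring_1)"
proof -
  have "card S \<le> n" using card_mono[OF _ assms] by simp
  then have "(Suc n - card S) * card S = (n - card S) * card S + card S"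
    by (simp add: Suc_diff_le)
  then have "(-1 :: 'k) ^ ((Suc n - card S) * card S) * (-1) ^ card S = (-1) ^ ((n - card S) * card S)"
    by (simp add: power_add mult.assoc flip: power_mult_distrib)
  then show ?thesis
    by (simp add: cup_sign_def shuffle_sign_Suc[OF assms] flip: mult.assoc)
qed

text \<open>
  With \<open>slice x f\<close>, \<open>translate x f\<close> and \<open>grade_sign f\<close>, a sum over all subsets of the coordinates of
  \<open>z\<close> becomes a recursion: on \<open>(z, x)\<close> the last coordinate is deleted either for \<open>f\<close> or for \<open>g\<close>, and
  in the second case it first acts on the argument of \<open>g\<close>.
\<close>

type_synonym 'p cochain = "'p symbol \<Rightarrow> 'p mod_ring"

definition grade_sign :: "'p::prime_card cochain \<Rightarrow> 'p cochain" where
  "grade_sign f z = (-1) ^ symbol_degree z * f z"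

definition slice :: "'p::prime_card dihedral \<Rightarrow> 'p cochain \<Rightarrow> 'p cochain" where
  "slice x f z = f (append_coordinate z x)"

definition translate :: "'p::prime_card dihedral \<Rightarrow> 'p cochain \<Rightarrow> 'p cochain" where
  "translate x f z = f (act x z)"

lemma cup_Nil: "cup f g (y, []) = f (y, []) * g (y, [])"
proof -
  have "{1..0::nat} = {}" by simp
  then show ?thesis
    by (simp only: cup_def Let_def snd_conv list.size) (simp add: shuffle_sign_def faces0_def faces1_def)
qed

lemma cup_append:
  "cup f g (append_coordinate z x) =
     cup (grade_sign f) (slice x g) z + cup (slice x f) (translate x g) z"
proof -
  define n where "n = symbol_degree z"
  let ?t = "\<lambda>S. cup_sign (Suc n) S * f (faces0 S (append_coordinate z x)) *
    g (faces1 ({1..Suc n} - S) (append_coordinate z x))"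
  have Pow: "Pow {1..Suc n} = Pow {1..n} \<union> insert (Suc n) ` Pow {1..n}"
    by (simp add: atLeastAtMostSuc_conv Pow_insert)
  have inj: "inj_on (insert (Suc n)) (Pow {1..n})"
  proof (rule inj_onI)
    fix S T assume "S \<in> Pow {1..n}" "T \<in> Pow {1..n}" "insert (Suc n) S = insert (Suc n) T"
    moreover from this have "Suc n \<notin> S" "Suc n \<notin> T" by auto
    ultimately show "S = T" by (simp add: insert_ident)
  qed
  have "cup f g (append_coordinate z x) = sum ?t (Pow {1..Suc n})"
    by (simp add: cup_def cup_sign_def n_def)
  also have "\<dots> = sum ?t (Pow {1..n}) + sum ?t (insert (Suc n) ` Pow {1..n})"
    unfolding Pow by (rule sum.union_disjoint) auto
  also have "sum ?t (insert (Suc n) ` Pow {1..n}) = (\<Sum>S\<in>Pow {1..n}. ?t (insert (Suc n) S))"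
    by (rule sum.reindex[OF inj, unfolded comp_def])
  also have "\<dots> = cup (grade_sign f) (slice x g) z"
    unfolding cup_def Let_def n_def[symmetric]
  proof (rule sum.cong)
    fix S assume "S \<in> Pow {1..n}"
    then have S: "S \<subseteq> {1..n}" by simp
    then have D: "{1..Suc n} - insert (Suc n) S = {1..n} - S" by auto
    show "?t (insert (Suc n) S) = (-1) ^ ((n - card S) * card S) * of_int (shuffle_sign n S) *
        grade_sign f (faces0 S z) * slice x g (faces1 ({1..n} - S) z)"
      using S unfolding D cup_sign_Suc_insert[OF S]
      by (simp add: n_def cup_sign_def grade_sign_def slice_def faces0_append_last degree_faces0
          faces1_append mult_ac)
  qed simp
  also have "sum ?t (Pow {1..n}) = cup (slice x f) (translate x g) z"
    unfolding cup_def Let_def n_def[symmetric]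
  proof (rule sum.cong)
    fix S assume "S \<in> Pow {1..n}"
    then have S: "S \<subseteq> {1..n}" by simp
    then have D: "{1..Suc n} - S = insert (Suc n) ({1..n} - S)" by auto
    show "?t S = (-1) ^ ((n - card S) * card S) * of_int (shuffle_sign n S) *
        slice x f (faces0 S z) * translate x g (faces1 ({1..n} - S) z)"
      using S unfolding D cup_sign_Suc[OF S]
      by (simp add: n_def cup_sign_def translate_def slice_def faces0_append
          faces1_append_last mult_ac)
  qed simp
  finally show ?thesis by simp
qed

text \<open>
  The product on cochains is bilinear; together with \<open>cup_append\<close> this reduces every identity
  between products to lower degrees.
\<close>

lemma cup_linear:
  "cup (\<lambda>z. f z + g z) h z = cup f h z + cup g h z"
  "cup f (\<lambda>z. g z + h z) z = cup f g z + cup f h z"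
  "cup (\<lambda>z. f z - g z) h z = cup f h z - cup g h z"
  "cup f (\<lambda>z. g z - h z) z = cup f g z - cup f h z"
  "cup (\<lambda>z. - f z) h z = - cup f h z"
  "cup f (\<lambda>z. - h z) z = - cup f h z"
  "cup (\<lambda>z. a * f z) h z = a * cup f h z"
  "cup f (\<lambda>z. a * h z) z = a * cup f h z"
  "cup (\<lambda>z. 0) h z = 0"
  "cup f (\<lambda>z. 0) z = 0"
  by (simp_all add: cup_def Let_def algebra_simps sum.distrib sum_subtractf sum_negf
      sum_distrib_left)

lemma grade_sign_grade_sign [simp]: "grade_sign (grade_sign f) = f"
  by (simp add: grade_sign_def fun_eq_iff flip: mult.assoc power_add)

lemma slice_grade_sign: "slice x (grade_sign f) = (\<lambda>z. - grade_sign (slice x f) z)"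
  by (simp add: slice_def grade_sign_def fun_eq_iff)

lemma translate_grade_sign: "translate x (grade_sign f) = grade_sign (translate x f)"
  by (simp add: translate_def grade_sign_def fun_eq_iff)

lemma slice_translate: "slice w (translate x f) = translate x (slice (w \<triangleright> x) f)"
  by (simp add: translate_def slice_def fun_eq_iff act_append_coordinate)

lemma translate_translate: "translate w (translate x f) = translate x (translate (w \<triangleright> x) f)"
  by (simp add: translate_def fun_eq_iff act_act[of x w])

lemma translate_cup: "translate x (cup f g) = cup (translate x f) (translate x g)"
proof
  show "translate x (cup f g) z = cup (translate x f) (translate x g) z" for z
  proof (induction z arbitrary: f g rule: symbol_induct)
    case (Nil y)
    then show ?case by (simp add: translate_def act_def cup_Nil)
  next
    case (append z w)
    have "translate x (cup f g) (append_coordinate z w) =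
        translate x (cup (grade_sign f) (slice (w \<triangleright> x) g)) z +
        translate x (cup (slice (w \<triangleright> x) f) (translate (w \<triangleright> x) g)) z"
      by (simp add: translate_def act_append_coordinate cup_append)
    then show ?case
      by (simp add: append cup_append slice_translate translate_translate[of w x]
          translate_grade_sign)
  qed
qed

lemma grade_sign_cup: "grade_sign (cup f g) = cup (grade_sign f) (grade_sign g)"
proof
  show "grade_sign (cup f g) z = cup (grade_sign f) (grade_sign g) z" for z
  proof (induction z arbitrary: f g rule: symbol_induct)
    case (Nil y)
    then show ?case by (simp add: grade_sign_def cup_Nil)
  next
    case (append z x)
    have "grade_sign (cup f g) (append_coordinate z x) =
        - grade_sign (cup (grade_sign f) (slice x g)) z
        - grade_sign (cup (slice x f) (translate x g)) z"
      by (simp add: grade_sign_def cup_append algebra_simps)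
    then show ?case
      by (simp add: append cup_append slice_grade_sign translate_grade_sign cup_linear)
  qed
qed

lemma slice_cup:
  "slice x (cup f g) = (\<lambda>z. cup (grade_sign f) (slice x g) z + cup (slice x f) (translate x g) z)"
  by (simp add: slice_def[of x "cup f g"] cup_append fun_eq_iff)

lemma cup_assoc: "cup (cup f g) h = cup f (cup g h)"
proof
  show "cup (cup f g) h z = cup f (cup g h) z" for z
  proof (induction z arbitrary: f g h rule: symbol_induct)
    case (Nil y)
    then show ?case by (simp add: cup_Nil)
  next
    case (append z x)
    then show ?case
      by (simp add: cup_append slice_cup grade_sign_cup translate_cup cup_linear)
  qed
qed

lemma slice_one: "slice x one_cochain = (\<lambda>_. 0)"
  and translate_one: "translate x one_cochain = one_cochain"
  and grade_sign_one: "grade_sign one_cochain = one_cochain"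
  by (simp_all add: fun_eq_iff slice_def translate_def grade_sign_def one_cochain_def)

lemma cup_one_left: "cup one_cochain f = f"
proof
  show "cup one_cochain f z = f z" for z
  proof (induction z arbitrary: f rule: symbol_induct)
    case (Nil y)
    then show ?case by (simp add: cup_Nil one_cochain_def)
  next
    case (append z x)
    then show ?case
      by (simp add: cup_append slice_one grade_sign_one cup_linear slice_def)
  qed
qed

lemma cup_one_right: "cup f one_cochain = f"
proof
  show "cup f one_cochain z = f z" for z
  proof (induction z arbitrary: f rule: symbol_induct)
    case (Nil y)
    then show ?case by (simp add: cup_Nil one_cochain_def)
  next
    case (append z x)
    then show ?case
      by (simp add: cup_append slice_one translate_one cup_linear slice_def)
  qed
qed


section \<open>The coboundary and its product rule\<close>

lemma eval_chain_superset:
  assumes "finite S" "Poly_Mapping.keys c \<subseteq> S"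
  shows "eval_chain F c = (\<Sum>z\<in>S. of_int (Poly_Mapping.lookup c z) * F z)"
  unfolding eval_chain_def
  by (rule sum.mono_neutral_left) (use assms in \<open>auto simp: in_keys_iff\<close>)

lemma eval_chain_add: "eval_chain F (c + d) = eval_chain F c + eval_chain F d"
proof -
  have "Poly_Mapping.keys (c + d) \<subseteq> Poly_Mapping.keys c \<union> Poly_Mapping.keys d"
    by (rule Poly_Mapping.keys_add)
  then show ?thesis
    by (simp add: eval_chain_superset[where S = "Poly_Mapping.keys c \<union> Poly_Mapping.keys d"]
        lookup_add distrib_right sum.distrib)
qed

lemma eval_chain_cmul: "eval_chain F (frag_cmul a c) = of_int a * eval_chain F c"
  by (subst eval_chain_superset[of "Poly_Mapping.keys c"])
    (auto simp: eval_chain_def sum_distrib_left mult.assoc)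

lemma eval_chain_diff: "eval_chain F (c - d) = eval_chain F c - eval_chain F d"
  using eval_chain_add[of F c "frag_cmul (-1) d"] eval_chain_cmul[of F "-1" d] by simp

lemma eval_chain_frag_of [simp]: "eval_chain F (frag_of z) = F z"
  by (simp add: eval_chain_def)

lemma eval_chain_sum: "eval_chain F (\<Sum>i\<in>I. c i) = (\<Sum>i\<in>I. eval_chain F (c i))"
  by (induction I rule: infinite_finite_induct)
    (auto simp: eval_chain_add, simp_all add: eval_chain_def)

abbreviation symbol_coboundary :: "'p::prime_card cochain \<Rightarrow> 'p cochain" where
  "symbol_coboundary \<equiv> coboundary symbol_boundary"

lemma symbol_coboundary_faces:
  "symbol_coboundary f z =
     (\<Sum>i = 1..symbol_degree z. (-1) ^ i * (f (face0 i z) - f (face1 i z)))"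
  by (simp add: coboundary_def symbol_boundary_def eval_chain_sum eval_chain_cmul eval_chain_diff)

lemma coboundary_Nil: "symbol_coboundary f (y, []) = 0"
  by (simp add: symbol_coboundary_faces)

lemma coboundary_append:
  "symbol_coboundary f (append_coordinate z x) =
     symbol_coboundary (slice x f) z - grade_sign f z + grade_sign (translate x f) z"
proof -
  have "(\<Sum>i = 1..symbol_degree z. (-1) ^ i * (f (face0 i (append_coordinate z x)) -
        f (face1 i (append_coordinate z x)))) = symbol_coboundary (slice x f) z"
    unfolding symbol_coboundary_faces
    by (rule sum.cong) (auto simp: face0_append face1_append slice_def)
  then show ?thesis
    unfolding symbol_coboundary_faces[of f "append_coordinate z x"]
    by (simp add: face0_append_last face1_append_last grade_sign_def translate_def algebra_simps)
qed

lemma slice_coboundary: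
  "slice x (symbol_coboundary f) =
     (\<lambda>z. symbol_coboundary (slice x f) z - grade_sign f z + grade_sign (translate x f) z)"
  by (simp add: slice_def[of x "symbol_coboundary f"] coboundary_append fun_eq_iff)

lemma translate_coboundary:
  "translate x (symbol_coboundary f) = symbol_coboundary (translate x f)"
  by (auto simp: fun_eq_iff translate_def symbol_coboundary_faces face0_act face1_act intro!: sum.cong)

lemma grade_sign_coboundary:
  "grade_sign (symbol_coboundary f) = (\<lambda>z. - symbol_coboundary (grade_sign f) z)"
proof
  fix z :: "'a symbol"
  have "(-1) ^ symbol_degree z * ((-1) ^ i * (f (face0 i z) - f (face1 i z))) =
      - ((-1) ^ i * (grade_sign f (face0 i z) - grade_sign f (face1 i z)))"
    if "i \<in> {1..symbol_degree z}" for i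
  proof -
    have "(-1) ^ symbol_degree z = - ((-1 :: 'a mod_ring) ^ (symbol_degree z - 1))"
      using that by (cases "symbol_degree z") auto
    then show ?thesis
      using that by (simp add: grade_sign_def degree_face0 degree_face1 algebra_simps)
  qed
  then show "grade_sign (symbol_coboundary f) z = - symbol_coboundary (grade_sign f) z"
    unfolding grade_sign_def[of "symbol_coboundary f"] symbol_coboundary_faces
      sum_distrib_left sum_negf[symmetric] by (rule sum.cong[OF refl])
qed

text \<open>
  The product rule at \<open>(z, x)\<close> follows from the rule at \<open>z\<close> for the pairs \<open>(grade_sign f, slice x g)\<close>
  and \<open>(slice x f, translate x g)\<close>: the boundary terms of the last coordinate cancel.
\<close>

lemma coboundary_cup:
  "symbol_coboundary (cup f g) =
     (\<lambda>z. cup (symbol_coboundary f) (grade_sign g) z + cup f (symbol_coboundary g) z)"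
proof
  show "symbol_coboundary (cup f g) z =
      cup (symbol_coboundary f) (grade_sign g) z + cup f (symbol_coboundary g) z" for z
  proof (induction z arbitrary: f g rule: symbol_induct)
    case (Nil y)
    then show ?case by (simp add: cup_Nil coboundary_Nil)
  next
    case (append z x)
    then show ?case
      by (simp add: coboundary_append cup_append slice_cup coboundary_add grade_sign_cup
          translate_cup slice_coboundary grade_sign_coboundary slice_grade_sign
          translate_grade_sign translate_coboundary cup_linear algebra_simps)
  qed
qed


section \<open>The operators on cochains\<close>

abbreviation Lambda_cochain :: "'p::prime_card cochain" where
  "Lambda_cochain \<equiv> P_cochain one_cochain"

lemma Lambda_cochain_eq: "Lambda_cochain z = (if symbol_degree z = 1 then 1 else 0)"
  by (cases z; cases "snd z") (auto simp: one_cochain_def)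

lemma slice_Lambda: "slice x Lambda_cochain = one_cochain"
  and translate_Lambda: "translate x Lambda_cochain = Lambda_cochain"
  and grade_sign_Lambda: "grade_sign Lambda_cochain = (\<lambda>z. - Lambda_cochain z)"
  by (simp_all add: fun_eq_iff slice_def translate_def grade_sign_def Lambda_cochain_eq
      one_cochain_def)

text \<open>
  As \<open>\<Lambda>\<close> is constant, its product with \<open>f\<close> is an alternating sum of the faces that delete a
  coordinate. So \<open>Q f\<close> is, up to sign, the simplicial coboundary of \<open>f\<close> as a function on all tuples
  \<open>(y, x\<^sub>1, \<dots>, x\<^sub>k)\<close>, with the base point \<open>y\<close> among the coordinates that are deleted.
\<close>

lemma cup_Lambda:
  "cup f Lambda_cochain (y, xs) =
     (\<Sum>a<length xs. (-1) ^ a * f (y, take a xs @ drop (Suc a) xs))"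
proof (induction xs arbitrary: f rule: rev_induct)
  case Nil
  then show ?case by (simp add: cup_Nil Lambda_cochain_eq)
next
  case (snoc x xs)
  have "cup f Lambda_cochain (y, xs @ [x]) =
      grade_sign f (y, xs) + cup (slice x f) Lambda_cochain (y, xs)"
    using cup_append[of f Lambda_cochain "(y, xs)" x]
    by (simp add: append_coordinate_def slice_Lambda translate_Lambda cup_one_right)
  then show ?case
    by (simp add: snoc grade_sign_def slice_def append_coordinate_def)
qed

text \<open>
  A Rota--Baxter identity: in \<open>P f \<union> \<Lambda>\<close> the coordinate deleted for \<open>f\<close> is either a later one, which
  gives \<open>P (f \<union> \<Lambda>)\<close>, or the first one, and then \<open>f\<close> no longer sees the first two entries of the
  symbol, as in \<open>P (P f)\<close>.
\<close>

lemma P_cup_Lambda: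
  "cup (P_cochain f) Lambda_cochain =
     (\<lambda>z. P_cochain (cup f Lambda_cochain) z - P_cochain (P_cochain (grade_sign f)) z)"
proof
  fix z
  show "cup (P_cochain f) Lambda_cochain z =
      P_cochain (cup f Lambda_cochain) z - P_cochain (P_cochain (grade_sign f)) z"
  proof (cases "(f, z)" rule: P_cochain.cases)
    case (1 F y)
    then show ?thesis by (simp add: cup_Lambda)
  next
    case (2 F y x xs)
    \<comment> \<open>The summand that deletes \<open>x\<close> is split off.\<close>
    have "cup (P_cochain f) Lambda_cochain (y, x # xs) = P_cochain f (y, xs) +
        (\<Sum>a<length xs. (-1) ^ Suc a * P_cochain f (y, x # take a xs @ drop (Suc a) xs))"
      unfolding cup_Lambda by (simp add: sum.lessThan_Suc_shift del: sum.lessThan_Suc)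
    also have "(\<Sum>a<length xs. (-1) ^ Suc a * P_cochain f (y, x # take a xs @ drop (Suc a) xs)) =
        (\<Sum>a<length xs. (-1) ^ length xs * ((-1) ^ a * f (x, take a xs @ drop (Suc a) xs)))"
    proof (rule sum.cong)
      fix a assume "a \<in> {..<length xs}"
      then obtain n where "length xs = Suc n" "a \<le> n" by (cases "length xs") auto
      then show "(-1) ^ Suc a * P_cochain f (y, x # take a xs @ drop (Suc a) xs) =
          (-1) ^ length xs * ((-1) ^ a * f (x, take a xs @ drop (Suc a) xs))"
        by (simp add: algebra_simps)
    qed simp
    also have "\<dots> = P_cochain (cup f Lambda_cochain) (y, x # xs)"
      by (simp add: cup_Lambda sum_distrib_left)
    also have "P_cochain f (y, xs) = - P_cochain (P_cochain (grade_sign f)) (y, x # xs)"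
      by (cases xs) (simp_all add: grade_sign_def flip: mult.assoc power_add)
    finally show ?thesis using 2 by simp
  qed
qed

lemma Q_cochain_eq: "Q_cochain f = (\<lambda>z. P_cochain f z - cup (grade_sign f) Lambda_cochain z)"
proof
  fix z
  have "(-1) ^ symbol_degree z * cup f Lambda_cochain z = - cup (grade_sign f) Lambda_cochain z"
    using fun_cong[OF grade_sign_cup[of f Lambda_cochain], of z]
    by (simp add: grade_sign_Lambda cup_linear grade_sign_def[of "cup f Lambda_cochain"])
  then show "Q_cochain f z = P_cochain f z - cup (grade_sign f) Lambda_cochain z"
    by (simp add: Q_cochain_def)
qed

text \<open>
  \<open>P f\<close> ignores the base point, so the two faces at the first coordinate cancel; the others are the
  faces of the symbol whose base point is the first coordinate.
\<close>

lemma coboundary_P: "symbol_coboundary (P_cochain f) = P_cochain (symbol_coboundary f)"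
proof
  fix z
  show "symbol_coboundary (P_cochain f) z = P_cochain (symbol_coboundary f) z"
  proof (cases "(f, z)" rule: P_cochain.cases)
    case (1 F y)
    then show ?thesis by (simp add: coboundary_Nil)
  next
    case (2 F y x xs)
    let ?d = "\<lambda>g i z. (-1) ^ i * (g (face0 i z) - g (face1 i z))"
    have "symbol_coboundary (P_cochain f) (y, x # xs) =
        ?d (P_cochain f) 1 (y, x # xs) + (\<Sum>k<length xs. ?d (P_cochain f) (Suc (Suc k)) (y, x # xs))"
      by (simp only: symbol_coboundary_faces sum.atLeast1_atMost_eq snd_conv list.size
          add_Suc_right add_0_right sum.lessThan_Suc_shift One_nat_def)
    also have "?d (P_cochain f) 1 (y, x # xs) = 0"
      by (cases xs) (auto simp: face0_def face1_def tuple_face0_def tuple_face1_def)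
    also have "(\<Sum>k<length xs. ?d (P_cochain f) (Suc (Suc k)) (y, x # xs)) =
        (\<Sum>k<length xs. (-1) ^ length xs * ?d f (Suc k) (x, xs))"
    proof (rule sum.cong)
      fix k assume "k \<in> {..<length xs}"
      then obtain n where "length xs = Suc n" "k \<le> n" by (cases "length xs") auto
      then show "?d (P_cochain f) (Suc (Suc k)) (y, x # xs) = (-1) ^ length xs * ?d f (Suc k) (x, xs)"
        by (simp add: face0_def face1_def tuple_face0_def tuple_face1_def algebra_simps)
    qed simp
    also have "\<dots> = P_cochain (symbol_coboundary f) (y, x # xs)"
      by (simp add: symbol_coboundary_faces sum.atLeast1_atMost_eq sum_distrib_left)
    finally show ?thesis using 2 by simp
  qed
qed

lemma P_cochain_linear:
  "P_cochain (\<lambda>z. f z + g z) z = P_cochain f z + P_cochain g z"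
  "P_cochain (\<lambda>z. a * f z) z = a * P_cochain f z"
  "P_cochain (\<lambda>z. f z - g z) z = P_cochain f z - P_cochain g z"
  "P_cochain (\<lambda>z. 0) z = 0"
  by (cases "(f, z)" rule: P_cochain.cases; simp add: algebra_simps)+

lemma graded_cup:
  assumes "f \<in> graded_cochains symbol_degree" "g \<in> graded_cochains symbol_degree"
  shows "cup f g \<in> graded_cochains symbol_degree"
proof -
  obtain M N where M: "\<And>z. f z \<noteq> 0 \<Longrightarrow> symbol_degree z \<le> M" and N: "\<And>z. g z \<noteq> 0 \<Longrightarrow> symbol_degree z \<le> N"
    using assms unfolding graded_cochains_def by blast
  have "symbol_degree z \<le> M + N" if nz: "cup f g z \<noteq> 0" for z
  proof -
    let ?n = "symbol_degree z"
    obtain S where "S \<subseteq> {1..?n}" and "f (faces0 S z) \<noteq> 0" "g (faces1 ({1..?n} - S) z) \<noteq> 0"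
      using nz unfolding cup_def Let_def
      by (auto elim!: sum.not_neutral_contains_not_neutral)
    moreover from this have "?n - card S \<le> M" "?n - card ({1..?n} - S) \<le> N"
      using M[of "faces0 S z"] N[of "faces1 ({1..?n} - S) z"] degree_faces0[of S z]
        degree_faces1[of "{1..?n} - S" z] by auto
    moreover have "card ({1..?n} - S) = ?n - card S"
      using \<open>S \<subseteq> {1..?n}\<close> by (simp add: card_Diff_subset finite_subset)
    ultimately show ?thesis by simp
  qed
  then show ?thesis unfolding graded_cochains_def by blast
qed

lemma graded_P:
  assumes "f \<in> graded_cochains symbol_degree"
  shows "P_cochain f \<in> graded_cochains symbol_degree"
proof -
  obtain M where M: "\<And>z. f z \<noteq> 0 \<Longrightarrow> symbol_degree z \<le> M"
    using assms unfolding graded_cochains_def by blast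
  have "symbol_degree z \<le> Suc M" if "P_cochain f z \<noteq> 0" for z
    using that M by (cases "(f, z)" rule: P_cochain.cases) force+
  then show ?thesis unfolding graded_cochains_def by blast
qed

lemma graded_grade_sign:
  "f \<in> graded_cochains symbol_degree \<Longrightarrow> grade_sign f \<in> graded_cochains symbol_degree"
  by (simp add: graded_cochains_def grade_sign_def)

lemma graded_one: "one_cochain \<in> graded_cochains symbol_degree"
  by (auto simp: graded_cochains_def one_cochain_def)

section \<open>The operations on cohomology classes\<close>

abbreviation symbol_cocycles :: "'p::prime_card cochain set" where
  "symbol_cocycles \<equiv> cocycles (graded_cochains symbol_degree) symbol_boundary"

abbreviation symbol_cohomologous :: "'p::prime_card cochain \<Rightarrow> 'p cochain \<Rightarrow> bool" where
  "symbol_cohomologous \<equiv> cohomologous (graded_cochains symbol_degree) symbol_boundary"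

lemma cocycles_cup: "f \<in> symbol_cocycles \<Longrightarrow> g \<in> symbol_cocycles \<Longrightarrow> cup f g \<in> symbol_cocycles"
  by (auto simp: cocycles_def graded_cup coboundary_cup cup_linear)

lemma cocycles_P: "f \<in> symbol_cocycles \<Longrightarrow> P_cochain f \<in> symbol_cocycles"
  by (auto simp: cocycles_def graded_P coboundary_P P_cochain_linear intro!: ext)

lemma cocycles_grade_sign: "f \<in> symbol_cocycles \<Longrightarrow> grade_sign f \<in> symbol_cocycles"
  using fun_cong[OF grade_sign_coboundary[of f]]
  by (auto simp: cocycles_def graded_grade_sign grade_sign_def[of "\<lambda>_. 0"])

lemma cocycles_one: "one_cochain \<in> symbol_cocycles"
proof -
  have "symbol_coboundary one_cochain z = (0 :: 'a mod_ring)" for z :: "'a symbol"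
    unfolding symbol_coboundary_faces
    by (rule sum.neutral) (auto simp: one_cochain_def degree_face0 degree_face1)
  then show ?thesis by (auto simp: cocycles_def graded_one)
qed

text \<open>
  The sign in the product rule is absorbed by \<open>grade_sign\<close>: a coboundary \<open>\<delta>h\<close> times a cocycle
  \<open>g\<close> is the coboundary of \<open>h \<union> grade_sign g\<close>.
\<close>

lemma cohomologous_cup:
  assumes "symbol_cohomologous f f'" "symbol_cohomologous g g'"
  shows "symbol_cohomologous (cup f g) (cup f' g')"
proof -
  from assms obtain h k where cyc: "f \<in> symbol_cocycles" "f' \<in> symbol_cocycles"
      "g \<in> symbol_cocycles" "g' \<in> symbol_cocycles"
    and h: "h \<in> graded_cochains symbol_degree" "\<And>z. f z - f' z = symbol_coboundary h z"
    and k: "k \<in> graded_cochains symbol_degree" "\<And>z. g z - g' z = symbol_coboundary k z"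
    unfolding cohomologous_def by blast
  let ?H = "\<lambda>z. cup h (grade_sign g) z + cup f' k z"
  have zero: "symbol_coboundary (grade_sign g) = (\<lambda>_. 0)" "symbol_coboundary f' = (\<lambda>_. 0)"
    using cyc cocycles_grade_sign[of g] by (auto simp: cocycles_def)
  have "cup f g z - cup f' g' z = cup (\<lambda>z. f z - f' z) g z + cup f' (\<lambda>z. g z - g' z) z" for z
    by (simp add: cup_linear)
  also have "\<dots> z = symbol_coboundary ?H z" for z
    unfolding h(2) k(2) by (simp add: coboundary_add coboundary_cup zero cup_linear)
  finally have "cup f g z - cup f' g' z = symbol_coboundary ?H z" for z .
  moreover have "?H \<in> graded_cochains symbol_degree"
    using cochain_module_graded[of symbol_degree] h(1) k(1) cyc
    unfolding cochain_module_def by (auto simp: cocycles_def intro!: graded_cup graded_grade_sign)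
  ultimately show ?thesis
    unfolding cohomologous_def using cyc cocycles_cup by blast
qed

lemma cohomologous_P:
  assumes "symbol_cohomologous f g"
  shows "symbol_cohomologous (P_cochain f) (P_cochain g)"
proof -
  from assms obtain h where cyc: "f \<in> symbol_cocycles" "g \<in> symbol_cocycles"
    and h: "h \<in> graded_cochains symbol_degree" "\<And>z. f z - g z = symbol_coboundary h z"
    unfolding cohomologous_def by blast
  have "P_cochain f z - P_cochain g z = symbol_coboundary (P_cochain h) z" for z
    unfolding coboundary_P P_cochain_linear(3)[symmetric] h(2) ..
  then show ?thesis
    unfolding cohomologous_def using cyc h(1) cocycles_P graded_P by blast
qed

lemma cohomologous_grade_sign:
  assumes "symbol_cohomologous f g"
  shows "symbol_cohomologous (grade_sign f) (grade_sign g)"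
proof -
  from assms obtain h where cyc: "f \<in> symbol_cocycles" "g \<in> symbol_cocycles"
    and h: "h \<in> graded_cochains symbol_degree" "\<And>z. f z - g z = symbol_coboundary h z"
    unfolding cohomologous_def by blast
  have "grade_sign f z - grade_sign g z = grade_sign (symbol_coboundary h) z" for z
    unfolding grade_sign_def h(2)[symmetric] by (simp add: algebra_simps)
  also have "\<dots> z = symbol_coboundary (\<lambda>z. (-1) * grade_sign h z) z" for z
    unfolding coboundary_scale grade_sign_coboundary by simp
  finally have "grade_sign f z - grade_sign g z =
    symbol_coboundary (\<lambda>z. (-1) * grade_sign h z) z" for z .
  moreover have "(\<lambda>z. (-1) * grade_sign h z) \<in> graded_cochains symbol_degree"
    using cochain_module_graded[of symbol_degree] graded_grade_sign[OF h(1)]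
    unfolding cochain_module_def by blast
  ultimately show ?thesis
    unfolding cohomologous_def using cyc cocycles_grade_sign by blast
qed

text \<open>
  The sign \<open>(-1)\<^sup>k\<close> in the definition of \<open>Q\<close> depends on the degree. As a linear operator on all degrees at
  once it lets the identities for \<open>P\<close> and \<open>Q\<close> hold for classes that are not homogeneous.
\<close>

lift_definition grade_involution :: "'p::prime_card symbol_cohomology \<Rightarrow> 'p symbol_cohomology"
  is grade_sign by (rule cohomologous_grade_sign)

lemma symbol_cohomologous_refl: "f \<in> symbol_cocycles \<Longrightarrow> symbol_cohomologous f f"
  by (rule cohomologous_refl[OF cochain_module_graded])

lemma symbol_cohomology_representative:
  obtains f where "f \<in> symbol_cocycles" "x = abs_symbol_cohomology f"
proof
  show "rep_symbol_cohomology x \<in> symbol_cocycles"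
    using Quotient_rep_reflp[OF Quotient_symbol_cohomology, of x] by (simp add: cohomologous_def)
  show "x = abs_symbol_cohomology (rep_symbol_cohomology x)"
    using Quotient_abs_rep[OF Quotient_symbol_cohomology] by metis
qed

lemma cohomologous_rep_abs:
  "f \<in> symbol_cocycles \<Longrightarrow> symbol_cohomologous (rep_symbol_cohomology (abs_symbol_cohomology f)) f"
  by (intro Quotient_rep_abs[OF Quotient_symbol_cohomology] symbol_cohomologous_refl)

lemma times_abs:
  "f \<in> symbol_cocycles \<Longrightarrow> g \<in> symbol_cocycles \<Longrightarrow>
    abs_symbol_cohomology f * abs_symbol_cohomology g = abs_symbol_cohomology (cup f g)"
  unfolding times_symbol_cohomology_def
  by (intro Quotient_rel_abs[OF Quotient_symbol_cohomology] cohomologous_cup cohomologous_rep_abs)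

lemma P_op_abs:
  "f \<in> symbol_cocycles \<Longrightarrow> P_op (abs_symbol_cohomology f) = abs_symbol_cohomology (P_cochain f)"
  unfolding P_op_def
  by (intro Quotient_rel_abs[OF Quotient_symbol_cohomology] cohomologous_P cohomologous_rep_abs)

lemma grade_involution_abs:
  "f \<in> symbol_cocycles \<Longrightarrow>
    grade_involution (abs_symbol_cohomology f) = abs_symbol_cohomology (grade_sign f)"
  by (intro grade_involution.abs_eq symbol_cohomologous_refl)

lemma plus_abs:
  "f \<in> symbol_cocycles \<Longrightarrow> g \<in> symbol_cocycles \<Longrightarrow>
    abs_symbol_cohomology f + abs_symbol_cohomology g = abs_symbol_cohomology (\<lambda>z. f z + g z)"
  by (intro plus_symbol_cohomology.abs_eq symbol_cohomologous_refl)

lemma scale_abs: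
  "f \<in> symbol_cocycles \<Longrightarrow>
    a *\<^sub>H abs_symbol_cohomology f = abs_symbol_cohomology (\<lambda>z. a * f z)"
  by (intro scale_cohomology.abs_eq symbol_cohomologous_refl)

lemmas symbol_cocycles_scale = cocycles_scale[OF cochain_module_graded, of _ symbol_degree]
lemmas symbol_cocycles_add = cocycles_add[OF cochain_module_graded, of _ symbol_degree]

lemma minus_abs:
  assumes "f \<in> symbol_cocycles" "g \<in> symbol_cocycles"
  shows "abs_symbol_cohomology f - abs_symbol_cohomology g = abs_symbol_cohomology (\<lambda>z. f z - g z)"
proof -
  have "- abs_symbol_cohomology g = abs_symbol_cohomology (\<lambda>z. (-1) * g z)"
    by (intro uminus_symbol_cohomology.abs_eq symbol_cohomologous_refl assms)
  then show ?thesis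
    using plus_abs[OF assms(1) symbol_cocycles_scale[OF assms(2), of "-1"]]
    by (simp add: minus_symbol_cohomology_def)
qed

lemmas abs_rules = times_abs P_op_abs grade_involution_abs plus_abs scale_abs minus_abs
  cocycles_cup cocycles_P cocycles_grade_sign cocycles_one symbol_cocycles_scale
  symbol_cocycles_add one_symbol_cohomology_def

lemma times_assoc: "(x * y) * z = x * (y * (z :: 'p::prime_card symbol_cohomology))"
  by (rule symbol_cohomology_representative[of x], rule symbol_cohomology_representative[of y],
      rule symbol_cohomology_representative[of z]) (simp add: abs_rules cup_assoc)

lemma one_times: "1 * x = (x :: 'p::prime_card symbol_cohomology)"
  by (rule symbol_cohomology_representative[of x]) (simp add: abs_rules cup_one_left)

abbreviation linear_operator ::
    "('p::prime_card symbol_cohomology \<Rightarrow> 'p symbol_cohomology) \<Rightarrow> bool" where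
  "linear_operator \<equiv> Vector_Spaces.linear scale_cohomology scale_cohomology"

interpretation cohomology_pair: vector_space_pair scale_cohomology scale_cohomology ..

lemma linear_operatorI:
  "\<lbrakk>\<And>x y. T (x + y) = T x + T y; \<And>a x. T (a *\<^sub>H x) = a *\<^sub>H T x\<rbrakk> \<Longrightarrow> linear_operator T"
  by (simp add: Vector_Spaces.linear_iff vector_space_scale_cohomology)

lemma linear_P_op: "linear_operator P_op"
proof (rule linear_operatorI)
  fix a and x y :: "'p::prime_card symbol_cohomology"
  show "P_op (x + y) = P_op x + P_op y"
    by (rule symbol_cohomology_representative[of x], rule symbol_cohomology_representative[of y])
      (simp add: abs_rules flip: P_cochain_linear)
  show "P_op (a *\<^sub>H x) = a *\<^sub>H P_op x"
    by (rule symbol_cohomology_representative[of x])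
      (simp add: abs_rules flip: P_cochain_linear)
qed

lemma linear_times_left:
  fixes v :: "'p::prime_card symbol_cohomology"
  shows "linear_operator (\<lambda>x. v * x)"
proof (rule linear_operatorI)
  fix a and x y :: "'p symbol_cohomology"
  show "v * (x + y) = v * x + v * y"
    by (rule symbol_cohomology_representative[of x], rule symbol_cohomology_representative[of y],
      rule symbol_cohomology_representative[of v]) (simp add: abs_rules flip: cup_linear)
  show "v * (a *\<^sub>H x) = a *\<^sub>H (v * x)"
    by (rule symbol_cohomology_representative[of x], rule symbol_cohomology_representative[of v])
      (simp add: abs_rules flip: cup_linear(8))
qed

lemma linear_times_right:
  fixes v :: "'p::prime_card symbol_cohomology"
  shows "linear_operator (\<lambda>x. x * v)"
proof (rule linear_operatorI)
  fix a and x y :: "'p symbol_cohomology"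
  show "(x + y) * v = x * v + y * v"
    by (rule symbol_cohomology_representative[of x], rule symbol_cohomology_representative[of y],
      rule symbol_cohomology_representative[of v]) (simp add: abs_rules flip: cup_linear)
  show "(a *\<^sub>H x) * v = a *\<^sub>H (x * v)"
    by (rule symbol_cohomology_representative[of x], rule symbol_cohomology_representative[of v])
      (simp add: abs_rules flip: cup_linear)
qed

lemma Q_op_eq: "Q_op x = P_op x - grade_involution x * P_op 1"
proof -
  define f where "f = rep_symbol_cohomology x"
  have f: "f \<in> symbol_cocycles" "x = abs_symbol_cohomology f"
    using Quotient_rep_reflp[OF Quotient_symbol_cohomology, of x]
      Quotient_abs_rep[OF Quotient_symbol_cohomology, of x]
    by (simp_all add: cohomologous_def f_def)
  have "Q_op x = abs_symbol_cohomology (Q_cochain f)"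
    by (simp add: Q_op_def f_def)
  then show ?thesis
    unfolding f(2) using f(1) by (simp add: abs_rules Q_cochain_eq)
qed

lemma P_op_times_Lambda:
  "P_op x * P_op 1 = P_op (x * P_op 1) - P_op (P_op (grade_involution x))"
  by (rule symbol_cohomology_representative[of x]) (simp add: abs_rules P_cup_Lambda)

section \<open>Words modulo the words with a trivial inner letter\<close>

lemma linear_maps_span:
  assumes "linear_operator T" "\<And>w. w \<in> W \<Longrightarrow> T w \<in> cohomology.span V" "x \<in> cohomology.span W"
  shows "T x \<in> cohomology.span V"
proof -
  have "T ` cohomology.span W = cohomology.span (T ` W)"
    using cohomology_pair.linear_span_image[OF assms(1)] by simp
  also have "\<dots> \<subseteq> cohomology.span V"
    using assms(2) by (intro cohomology.span_minimal cohomology.subspace_span) auto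
  finally show ?thesis using assms(3) by auto
qed

text \<open>
  The linear map that fixes \<open>w j\<close> for \<open>j\<close> in \<open>J\<close> and kills \<open>w i\<close> for all other \<open>i\<close> sends \<open>u j\<close> to \<open>w j\<close>.
  A relation between the \<open>u j\<close> would therefore give the same relation between the \<open>w j\<close>.
\<close>

lemma independent_family_perturbation:
  fixes w u :: "'i \<Rightarrow> 'p::prime_card symbol_cohomology"
  assumes w: "independent_family I w" and J: "J \<subseteq> I"
    and u: "\<And>j. j \<in> J \<Longrightarrow> u j - w j \<in> cohomology.span (w ` (I - J))"
  shows "independent_family J u"
proof -
  have inj: "inj_on w I" and ind: "cohomology.independent (w ` I)"
    using w by (auto simp: independent_family_def)
  obtain T where T: "linear_operator T"
    "\<And>x. x \<in> w ` I \<Longrightarrow> T x = (if x \<in> w ` J then x else 0)"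
    using cohomology_pair.linear_independent_extend[OF ind, of "\<lambda>x. if x \<in> w ` J then x else 0"]
    by blast
  interpret T: Vector_Spaces.linear scale_cohomology scale_cohomology T by (rule T(1))
  have Tz: "T x = 0" if "x \<in> cohomology.span (w ` (I - J))" for x
    using that
  proof (rule cohomology_pair.linear_eq_0_on_span[OF T(1), rotated])
    fix x assume "x \<in> w ` (I - J)"
    then show "T x = 0"
      using inj_on_image_mem_iff[OF inj _ J] T(2)[of x] by auto
  qed
  have Tu: "T (u j) = w j" if "j \<in> J" for j
  proof -
    have "T (u j) - T (w j) = 0"
      using Tz[OF u[OF that]] by (simp add: T.diff)
    then show ?thesis using T(2)[of "w j"] that J by auto
  qed
  have inj_wJ: "inj_on w J" using inj J by (rule inj_on_subset)
  have "cohomology.independent (u ` J)"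
  proof
    assume "cohomology.dependent (u ` J)"
    then obtain j where j: "j \<in> J" and "u j \<in> cohomology.span (u ` J - {u j})"
      by (auto simp: cohomology.dependent_def)
    then have "T (u j) \<in> cohomology.span (T ` (u ` J - {u j}))"
      using T.span_image[of "u ` J - {u j}"] by blast
    moreover have "T ` (u ` J - {u j}) \<subseteq> w ` J - {w j}"
      using Tu j inj_onD[OF inj_wJ] by force
    ultimately have "w j \<in> cohomology.span (w ` J - {w j})"
      using cohomology.span_mono Tu[OF j] by (metis subsetD)
    then have "cohomology.dependent (w ` J)"
      using j by (auto simp: cohomology.dependent_def)
    moreover have "cohomology.independent (w ` J)"
      using ind J by (meson cohomology.independent_mono image_mono)
    ultimately show False by blast
  qed
  moreover have "inj_on u J"
    using Tu inj_wJ by (metis inj_on_def)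
  ultimately show ?thesis by (simp add: independent_family_def)
qed

text \<open>
  The words excluded from the family of the theorem are those with the letter \<open>(0, 0)\<close> at a position
  other than the first one.
\<close>

definition degenerate_span ::
    "(nat \<Rightarrow> 'p::prime_card symbol_cohomology) \<Rightarrow> 'p symbol_cohomology \<Rightarrow>
     'p symbol_cohomology set" where
  "degenerate_span A B = cohomology.span (iterated_product P_op A B `
     {s \<in> index_sequences. (0, 0) \<in> set (tl s)})"

context
  fixes A :: "nat \<Rightarrow> 'p::prime_card symbol_cohomology"
    and B :: "'p symbol_cohomology"
  assumes A_0: "A 0 = 1"
    and spanning: "cohomology.span (iterated_product P_op A B ` index_sequences) = UNIV"
begin

lemma iterated_product_Cons:
  "s \<noteq> [] \<Longrightarrow> iterated_product T A B ((m, e) # s) = A m * B ^ e * T (iterated_product T A B s)"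
  by (cases s) auto

lemma index_sequences_Cons:
  "s \<noteq> [] \<Longrightarrow> (m, e) # s \<in> index_sequences \<longleftrightarrow> e \<in> {0, 1} \<and> s \<in> index_sequences"
  by (auto simp: index_sequences_def)

text \<open>
  Since \<open>A\<^sub>0\<close> is the unit, \<open>P\<close> prefixes a word with the letter \<open>(0, 0)\<close>. At the front that letter is
  harmless, but a further \<open>P\<close> moves it to the inside.
\<close>

lemma P_op_word:
  "s \<noteq> [] \<Longrightarrow> P_op (iterated_product P_op A B s) = iterated_product P_op A B ((0, 0) # s)"
  by (simp add: iterated_product_Cons A_0 one_times)

lemma word_in_degenerate_span:
  "s \<in> index_sequences \<Longrightarrow> (0, 0) \<in> set (tl s) \<Longrightarrow> iterated_product P_op A B s \<in> degenerate_span A B"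
  unfolding degenerate_span_def by (rule cohomology.span_base) auto

lemma linear_letter_P: "linear_operator (\<lambda>x. v * P_op x)"
  using Vector_Spaces.linear_compose[OF linear_P_op linear_times_left] by (simp add: comp_def)

lemma letter_P_degenerate:
  assumes e: "e \<in> {0, 1}" and "x \<in> degenerate_span A B"
  shows "A m * B ^ e * P_op x \<in> degenerate_span A B"
  using assms(2) unfolding degenerate_span_def
proof (rule linear_maps_span[OF linear_letter_P, rotated])
  fix w assume "w \<in> iterated_product P_op A B ` {s \<in> index_sequences. (0, 0) \<in> set (tl s)}"
  then obtain s where s: "s \<in> index_sequences" "(0, 0) \<in> set (tl s)"
    "w = iterated_product P_op A B s" by auto
  then have "s \<noteq> []" by auto
  then have "A m * B ^ e * P_op w = iterated_product P_op A B ((m, e) # s)"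
    "(m, e) # s \<in> index_sequences"
    using s e by (simp_all add: iterated_product_Cons index_sequences_Cons)
  moreover have "(0, 0) \<in> set s"
    using s(2) list.set_sel(2)[OF \<open>s \<noteq> []\<close>] by blast
  ultimately show "A m * B ^ e * P_op w \<in> cohomology.span (iterated_product P_op A B `
      {s \<in> index_sequences. (0, 0) \<in> set (tl s)})"
    using word_in_degenerate_span[of "(m, e) # s"] by (simp add: degenerate_span_def)
qed

text \<open>
  The words span, so \<open>P \<circ> P\<close> may be applied to an arbitrary class: this covers the class
  \<open>grade_involution w\<close> for a word \<open>w\<close>.
\<close>

lemma letter_P_P_degenerate:
  assumes e: "e \<in> {0, 1}"
  shows "A m * B ^ e * P_op (P_op x) \<in> degenerate_span A B"
proof -
  have lin: "linear_operator (\<lambda>x. A m * B ^ e * P_op (P_op x))"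
    using Vector_Spaces.linear_compose[OF linear_P_op linear_letter_P] by (simp add: comp_def)
  have "x \<in> cohomology.span (iterated_product P_op A B ` index_sequences)"
    by (simp add: spanning)
  then show ?thesis
    unfolding degenerate_span_def
  proof (rule linear_maps_span[OF lin, rotated])
    fix w assume "w \<in> iterated_product P_op A B ` index_sequences"
    then obtain s where s: "s \<in> index_sequences" "w = iterated_product P_op A B s" by auto
    then have "s \<noteq> []" by (auto simp: index_sequences_def)
    then have "P_op w = iterated_product P_op A B ((0, 0) # s)"
      using s P_op_word by blast
    then have "A m * B ^ e * P_op (P_op w) = iterated_product P_op A B ((m, e) # (0, 0) # s)"
      using iterated_product_Cons[where s = "(0, 0) # s" and T = P_op and m = m and e = e] by simp
    moreover have "(m, e) # (0, 0) # s \<in> index_sequences"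
      using s e \<open>s \<noteq> []\<close> by (simp add: index_sequences_Cons)
    ultimately show "A m * B ^ e * P_op (P_op w) \<in> cohomology.span (iterated_product P_op A B `
        {s \<in> index_sequences. (0, 0) \<in> set (tl s)})"
      using word_in_degenerate_span[of "(m, e) # (0, 0) # s"] by (simp add: degenerate_span_def)
  qed
qed

text \<open>
  Multiplying a word by \<open>\<Lambda>\<close> inserts \<open>(0, 0)\<close>, with signs, at all positions behind the first letter.
  By associativity the first letter stays in front, and the identity for \<open>P x \<union> \<Lambda>\<close> either inserts
  the new letter right behind it or leaves the insertion to the rest of the word.
\<close>

lemma word_times_Lambda:
  "s \<in> index_sequences \<Longrightarrow> iterated_product P_op A B s * P_op 1 \<in> degenerate_span A B"
proof (induction s)
  case Nil
  then show ?case by (simp add: index_sequences_def)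
next
  case (Cons a s)
  obtain m e where a: "a = (m, e)" by (cases a)
  show ?case
  proof (cases "s = []")
    case True
    have "iterated_product P_op A B (a # s) * P_op 1 = iterated_product P_op A B [(m, e), (0, 0)]"
      using True a iterated_product_Cons[of "[(0, 0)]" P_op m e] by (simp add: A_0 one_times)
    moreover have "[(m, e), (0, 0)] \<in> index_sequences"
      using Cons.prems a by (auto simp: index_sequences_def)
    ultimately show ?thesis using word_in_degenerate_span[of "[(m, e), (0, 0)]"] by simp
  next
    case False
    let ?w = "iterated_product P_op A B s"
    have e: "e \<in> {0, 1}" and s: "s \<in> index_sequences"
      using Cons.prems False a by (auto simp: index_sequences_Cons)
    have "iterated_product P_op A B (a # s) * P_op 1 = A m * B ^ e * (P_op ?w * P_op 1)"
      using False a by (simp add: iterated_product_Cons times_assoc)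
    also have "\<dots> = A m * B ^ e * P_op (?w * P_op 1) - A m * B ^ e * P_op (P_op (grade_involution ?w))"
      unfolding P_op_times_Lambda by (rule cohomology_pair.linear_diff[OF linear_times_left])
    also have "\<dots> \<in> degenerate_span A B"
      using letter_P_degenerate[OF e Cons.IH[OF s]] letter_P_P_degenerate[OF e]
      unfolding degenerate_span_def by (intro cohomology.span_diff)
    finally show ?thesis .
  qed
qed

lemma times_Lambda: "x * P_op 1 \<in> degenerate_span A B"
proof -
  have "x \<in> cohomology.span (iterated_product P_op A B ` index_sequences)"
    by (simp add: spanning)
  then show ?thesis
    unfolding degenerate_span_def
    by (rule linear_maps_span[OF linear_times_right, rotated])
      (use word_times_Lambda in \<open>auto simp: degenerate_span_def\<close>)
qed

text \<open>
  For a letter \<open>v\<close> the difference between \<open>v \<union> Q x\<close> and \<open>v \<union> P x\<close> is \<open>v \<union> (x' \<union> \<Lambda>)\<close> with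
  \<open>x' = grade_involution x\<close>. Rewriting it as \<open>(v \<union> x') \<union> \<Lambda>\<close> puts it into the degenerate span,
  whatever the class \<open>v \<union> x'\<close> is.
\<close>

lemma Q_word_minus_P_word:
  "s \<in> index_sequences \<Longrightarrow> iterated_product Q_op A B s - iterated_product P_op A B s \<in> degenerate_span A B"
proof (induction s)
  case Nil
  then show ?case by (simp add: index_sequences_def)
next
  case (Cons a s)
  obtain m e where a: "a = (m, e)" by (cases a)
  show ?case
  proof (cases "s = []")
    case True
    then show ?thesis by (simp add: a degenerate_span_def cohomology.span_zero)
  next
    case False
    let ?q = "iterated_product Q_op A B s" and ?w = "iterated_product P_op A B s"
    let ?v = "A m * B ^ e"
    have e: "e \<in> {0, 1}" and s: "s \<in> index_sequences"
      using Cons.prems False a by (auto simp: index_sequences_Cons)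
    have "?v * Q_op ?q = ?v * P_op ?q - ?v * (grade_involution ?q * P_op 1)"
      unfolding Q_op_eq by (rule cohomology_pair.linear_diff[OF linear_times_left])
    moreover have "?v * P_op (?q - ?w) = ?v * P_op ?q - ?v * P_op ?w"
      by (rule cohomology_pair.linear_diff[OF linear_letter_P])
    ultimately have "iterated_product Q_op A B (a # s) - iterated_product P_op A B (a # s) =
        ?v * P_op (?q - ?w) - (?v * grade_involution ?q) * P_op 1"
      using False a by (simp add: iterated_product_Cons times_assoc)
    also have "\<dots> \<in> degenerate_span A B"
      using letter_P_degenerate[OF e Cons.IH[OF s]] times_Lambda
      unfolding degenerate_span_def by (intro cohomology.span_diff)
    finally show ?thesis .
  qed
qed

end

theorem proposition52:
  fixes A :: "nat \<Rightarrow> 'p::prime_card symbol_cohomology"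
    and B :: "'p symbol_cohomology"
  assumes "odd CARD('p)"
    and "\<And>m. quandle_class (2 * m) (A m)"
    and "A 0 = 1"
    and "quandle_class 3 B"
    and "\<And>k m. A k * A m = of_nat ((k + m) choose k) *\<^sub>H A (k + m)"
    and "basis_family index_sequences (iterated_product P_op A B)"
  shows "independent_family {s \<in> index_sequences. \<forall>(m, e) \<in> set (tl s). (m, e) \<noteq> (0, 0)}
           (iterated_product Q_op A B)"
proof (rule independent_family_perturbation)
  let ?J = "{s \<in> index_sequences. \<forall>(m, e) \<in> set (tl s). (m, e) \<noteq> (0, 0)}"
  show "independent_family index_sequences (iterated_product P_op A B)"
    using assms(6) by (simp add: basis_family_def)
  have "cohomology.span (iterated_product P_op A B ` index_sequences) = UNIV"
    using assms(6) by (simp add: basis_family_def)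
  note minus = Q_word_minus_P_word[where A = A and B = B, OF assms(3) this]
  have "index_sequences - ?J = {s \<in> index_sequences. (0, 0) \<in> set (tl s)}"
    by auto
  then show "iterated_product Q_op A B s - iterated_product P_op A B s \<in>
      cohomology.span (iterated_product P_op A B ` (index_sequences - ?J))" if "s \<in> ?J" for s
    using minus[of s] that degenerate_span_def[of A B] by simp
qed auto

end
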